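(* Let $X$ be a nonempty set, let $d\in\mathbb{N}$, and let $\mathbf{K}:X\times X\to\mathbb{R}^{d\times d}$ be an admissible multi-task kernel. Then $\mathcal{B}_{\mathbf{K}}$ and $\mathcal{B}_{\mathbf{K}}^{\#}$ are a pair of vector-valued reproducing kernel Banach spaces (with respect to the bilinear form $(\cdot,\cdot)_{\mathbf{K}}$), and $\mathbf{K}$ is a reproducing kernel for $\mathcal{B}_{\mathbf{K}}$ and $\mathcal{B}_{\mathbf{K}}^{\#}$; that is, for all $x\in X$ and $\boldsymbol{c}\in\mathbb{R}^d$ one has $\mathbf{K}(\cdot,x)\boldsymbol{c}\in\mathcal{B}_{\mathbf{K}}^{\#}$, $\mathbf{K}(x,\cdot)\boldsymbol{c}\in\mathcal{B}_{\mathbf{K}}$, and $$(f,\mathbf{K}(\cdot,x)\boldsymbol{c})_{\mathbf{K}}=f(x)^\top\boldsymbol{c}\ \text{ for all } f\in\mathcal{B}_{\mathbf{K}},\qquad (\mathbf{K}(x,\cdot)\boldsymbol{c},g)_{\mathbf{K}}=\boldsymbol{c}^\top g(x)\ \text{ for all } g\in\mathcal{B}_{\mathbf{K}}^{\#}.$$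
   Context: $\mathbb{N}=\{1,2,\dots\}$. For a vector, $\|\cdot\|_p$ is the $\ell^p$ norm; for a matrix, $\|\cdot\|_p$ is the $\ell^p$-induced operator norm. For a nonempty set $\Omega$, $\ell^1_d(\Omega)=\{\boldsymbol{c}=(\boldsymbol{c}_t\in\mathbb{R}^d:t\in\Omega): \|\boldsymbol{c}\|_{\ell^1_d(\Omega)}=\sum_{t\in\Omega}\|\boldsymbol{c}_t\|_1<\infty\}$, and $\mathrm{supp}\,\boldsymbol{c}=\{t:\boldsymbol{c}_t\ne0\}$ (at most countable). Admissible multi-task kernel: a function $\mathbf{K}:X\times X\to\mathbb{R}^{d\times d}$ with $\mathbf{K}(x,x')^\top=\mathbf{K}(x,x')$ for all $x,x'\in X$ such that (A1) for all $m\in\mathbb{N}$ and pairwise distinct $x_1,\dots,x_m\in X$, the $md\times md$ block matrix $\mathbf{K}[\mathbf{x}]$ whose $(j,k)$ block is $\mathbf{K}(x_k,x_j)$ is non-singular; (A2) there is $\kappa>0$ with $\|\mathbf{K}(x,x')\|_1\le\kappa$ for all $x,x'\in X$; (A3) for all pairwise distinct $x_j\in X$, $j\in\mathbb{N}$, and $(\boldsymbol{c}_j)_{j\in\mathbb{N}}\in\ell^1_d(\mathbb{N})$, if $\sum_{j\in\mathbb{N}}\mathbf{K}(x_j,x)\boldsymbol{c}_j=0$ for all $x\in X$, then $\boldsymbol{c}_j=0$ for all $j$. The space $\mathcal{B}_{\mathbf{K}}=\{\sum_{x\in\mathrm{supp}\,\boldsymbol{c}}\mathbf{K}(x,\cdot)\boldsymbol{c}_x:\boldsymbol{c}\in\ell^1_d(X)\}$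 carries the norm $\|\sum_{x\in\mathrm{supp}\,\boldsymbol{c}}\mathbf{K}(x,\cdot)\boldsymbol{c}_x\|_{\mathcal{B}_{\mathbf{K}}}=\|\boldsymbol{c}\|_{\ell^1_d(X)}$. Let $\mathcal{B}_0\subseteq\mathcal{B}_{\mathbf{K}}$ be the subspace of finite sums $\sum_{j=1}^m\mathbf{K}(x_j,\cdot)\boldsymbol{c}_j$; it is dense in $\mathcal{B}_{\mathbf{K}}$. Let $\mathcal{B}_0^{\#}=\{\sum_{k=1}^n\mathbf{K}(\cdot,x_k)\boldsymbol{b}_k: n\in\mathbb{N},\,x_k\in X,\,\boldsymbol{b}_k\in\mathbb{R}^d\}$ with norm $\|g\|_{\mathcal{B}_0^{\#}}=\sup_{t\in X}\|g(t)\|_\infty$. The space $\mathcal{B}_{\mathbf{K}}^{\#}$ consists of all functions $g:X\to\mathbb{R}^d$ that are pointwise limits of sequences in $\mathcal{B}_0^{\#}$ that are Cauchy for $\|\cdot\|_{\mathcal{B}_0^{\#}}$, with norm $\|g\|_{\mathcal{B}_{\mathbf{K}}^{\#}}=\sup_{x\in X}\|g(x)\|_\infty$. The bilinear form is defined on $\mathcal{B}_0\times\mathcal{B}_0^{\#}$ by $\big(\sum_{j=1}^m\mathbf{K}(x_j,\cdot)\boldsymbol{c}_j,\sum_{k=1}^n\mathbf{K}(\cdot,s_k)\boldsymbol{b}_k\big)_{\mathbf{K}}=\sum_{k=1}^n\sum_{j=1}^m\boldsymbol{c}_j^\top\mathbf{K}(x_j,s_k)\boldsymbol{b}_k$; it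 satisfies $|(f,g)_{\mathbf{K}}|\le\|f\|_{\mathcal{B}_{\mathbf{K}}}\|g\|_{\mathcal{B}_0^{\#}}$, and $(\cdot,\cdot)_{\mathbf{K}}$ also denotes its continuous extension to $\mathcal{B}_{\mathbf{K}}\times\mathcal{B}_{\mathbf{K}}^{\#}$, satisfying $|(f,g)_{\mathbf{K}}|\le\|f\|_{\mathcal{B}_{\mathbf{K}}}\|g\|_{\mathcal{B}_{\mathbf{K}}^{\#}}$. A vector-valued RKBS from $X$ to $\mathbb{R}^d$ is a Banach space $\mathcal{B}$ of functions $f:X\to\mathbb{R}^d$ (with $\|f\|_{\mathcal{B}}=0$ iff $f\equiv0$ pointwise) such that every point evaluation $f\mapsto f(x)$ is continuous. Two vector-valued RKBSs $\mathcal{B},\mathcal{B}^{\#}$ from $X$ to $\mathbb{R}^d$ are a pair of vector-valued RKBSs with kernel $\mathbf{K}$ if there is a continuous bilinear form on $\mathcal{B}\times\mathcal{B}^{\#}$ for which the memberships $\mathbf{K}(\cdot,x)\boldsymbol{c}\in\mathcal{B}^{\#}$, $\mathbf{K}(x,\cdot)\boldsymbol{c}\in\mathcal{B}$ and the two reproducing properties displayed in the claim (with $\mathcal{B},\mathcal{B}^{\#}$ in place of $\mathcal{B}_{\mathbf{K}},\mathcal{B}_{\mathbf{K}}^{\#}$) hold for all $x\in X$, $\boldsymbol{c}\in\mathbb{R}^d$. *)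

theory Defs
  imports "HOL-Analysis.Analysis" "Jordan_Normal_Form.Matrix"
begin

no_notation Matrix.vec_index (infixl \<open>$\<close> 100)
no_notation Matrix.scalar_prod (infix \<open>\<bullet>\<close> 70)

text \<open>
  The input set is the type \<open>'x\<close>, and the output space is \<open>real ^ 'd\<close> with \<open>d = CARD('d)\<close>.
  The ambient norm of \<open>real ^ 'd\<close> is only used for its topology; all quantitative notions use the
  \<open>\<ell>\<^sup>1\<close> norm below or the maximum norm \<^const>\<open>infnorm\<close>.
\<close>

definition l1norm :: "real ^ 'd \<Rightarrow> real" where
  "l1norm v = (\<Sum>i\<in>UNIV. \<bar>v $ i\<bar>)"

text \<open>Same shape as \<^const>\<open>onorm\<close>; the quotient is \<open>0\<close> at \<open>v = 0\<close>.\<close>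

definition l1_onorm :: "real ^ 'd ^ 'd \<Rightarrow> real" where
  "l1_onorm A = (SUP v. l1norm (A *v v) / l1norm v)"

definition l1d :: "('t \<Rightarrow> real ^ 'd) set" where
  "l1d = {c. (\<lambda>t. l1norm (c t)) summable_on UNIV}"

definition l1d_norm :: "('t \<Rightarrow> real ^ 'd) \<Rightarrow> real" where
  "l1d_norm c = (\<Sum>\<^sub>\<infinity>t. l1norm (c t))"


section \<open>Admissible multi-task kernels\<close>

text \<open>
  The \<open>md \<times> md\<close> matrix whose \<open>(j, k)\<close> block is \<open>K (x k) (x j)\<close>, for \<open>j, k < m\<close>. Row \<open>p\<close> lies in
  block row \<open>p div d\<close> and has position \<open>p mod d\<close> inside the block; columns are treated likewise. The
  index type \<open>'d\<close> is enumerated by \<^const>\<open>from_nat_into\<close>, a bijection from \<open>{..<CARD('d)}\<close>; the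
  choice of enumeration only conjugates the matrix by a permutation.
\<close>

definition kernel_matrix ::
    "('x \<Rightarrow> 'x \<Rightarrow> real ^ 'd ^ 'd) \<Rightarrow> nat \<Rightarrow> (nat \<Rightarrow> 'x) \<Rightarrow> real mat" where
  "kernel_matrix K m x =
     (let d = CARD('d); e = from_nat_into (UNIV :: 'd set) in
      Matrix.mat (m * d) (m * d)
        (\<lambda>(p, q). K (x (q div d)) (x (p div d)) $ e (p mod d) $ e (q mod d)))"

definition admissible_kernel :: "('x \<Rightarrow> 'x \<Rightarrow> real ^ 'd ^ 'd) \<Rightarrow> bool" where
  "admissible_kernel K \<longleftrightarrow>
     (\<forall>x x'. Finite_Cartesian_Product.transpose (K x x') = K x x') \<and>
     (\<forall>m\<ge>1. \<forall>x. inj_on x {..<m} \<longrightarrow> invertible_mat (kernel_matrix K m x)) \<and>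
     (\<exists>\<kappa>>0. \<forall>x x'. l1_onorm (K x x') \<le> \<kappa>) \<and>
     (\<forall>x :: nat \<Rightarrow> 'x. inj x \<longrightarrow>
        (\<forall>c\<in>l1d. (\<forall>y. ((\<lambda>j. K (x j) y *v c j) has_sum 0) UNIV) \<longrightarrow> (\<forall>j. c j = 0)))"


section \<open>Pairs of vector-valued reproducing kernel Banach spaces\<close>

text \<open>A function space is given by its carrier \<open>B\<close> and its norm \<open>N\<close>, which is only meaningful on
  \<open>B\<close>; the vector space operations are pointwise.\<close>

definition normed_fun_space ::
    "('x \<Rightarrow> real ^ 'd) set \<Rightarrow> (('x \<Rightarrow> real ^ 'd) \<Rightarrow> real) \<Rightarrow> bool" where
  "normed_fun_space B N \<longleftrightarrow>
     (\<lambda>x. 0) \<in> B \<and>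
     (\<forall>f\<in>B. \<forall>g\<in>B. (\<lambda>x. f x + g x) \<in> B) \<and>
     (\<forall>a. \<forall>f\<in>B. (\<lambda>x. a *\<^sub>R f x) \<in> B) \<and>
     (\<forall>f\<in>B. 0 \<le> N f) \<and>
     (\<forall>f\<in>B. N f = 0 \<longleftrightarrow> (\<forall>x. f x = 0)) \<and>
     (\<forall>a. \<forall>f\<in>B. N (\<lambda>x. a *\<^sub>R f x) = \<bar>a\<bar> * N f) \<and>
     (\<forall>f\<in>B. \<forall>g\<in>B. N (\<lambda>x. f x + g x) \<le> N f + N g)"

text \<open>The locale \<^locale>\<open>Metric_space\<close> requires non-negativity and symmetry also outside of the
  carrier, hence the guard.\<close>

definition norm_dist ::
    "('x \<Rightarrow> real ^ 'd) set \<Rightarrow> (('x \<Rightarrow> real ^ 'd) \<Rightarrow> real) \<Rightarrow>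
     ('x \<Rightarrow> real ^ 'd) \<Rightarrow> ('x \<Rightarrow> real ^ 'd) \<Rightarrow> real" where
  "norm_dist B N f g = (if f \<in> B \<and> g \<in> B then N (\<lambda>x. f x - g x) else 0)"

lemma Metric_space_norm_dist:
  assumes "normed_fun_space B N"
  shows "Metric_space B (norm_dist B N)"
proof
  have add: "(\<lambda>x. f x + g x) \<in> B" if "f \<in> B" "g \<in> B" for f g
    using assms that unfolding normed_fun_space_def by simp
  have smult: "(\<lambda>x. a *\<^sub>R f x) \<in> B" if "f \<in> B" for a f
    using assms that unfolding normed_fun_space_def by simp
  have nonneg: "0 \<le> N f" if "f \<in> B" for f
    using assms that unfolding normed_fun_space_def by simp
  have zero: "N f = 0 \<longleftrightarrow> (\<forall>x. f x = 0)" if "f \<in> B" for f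
    using assms that unfolding normed_fun_space_def by simp
  have scale: "N (\<lambda>x. a *\<^sub>R f x) = \<bar>a\<bar> * N f" if "f \<in> B" for a f
    using assms that unfolding normed_fun_space_def by simp
  have tri: "N (\<lambda>x. f x + g x) \<le> N f + N g" if "f \<in> B" "g \<in> B" for f g
    using assms that unfolding normed_fun_space_def by simp
  have diff: "(\<lambda>x. f x - g x) \<in> B" if "f \<in> B" "g \<in> B" for f g
    using add[OF that(1) smult[OF that(2), of "-1"]] by simp
  fix f g h
  show "0 \<le> norm_dist B N f g"
    using nonneg diff by (simp add: norm_dist_def)
  show "norm_dist B N f g = norm_dist B N g f"
    using scale[OF diff, of f g "-1"] by (auto simp: norm_dist_def)
  show "norm_dist B N f g = 0 \<longleftrightarrow> f = g" if "f \<in> B" "g \<in> B"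
    using zero[OF diff[OF that]] that by (auto simp: norm_dist_def)
  show "norm_dist B N f h \<le> norm_dist B N f g + norm_dist B N g h"
    if "f \<in> B" "g \<in> B" "h \<in> B"
    using tri[OF diff[OF that(1,2)] diff[OF that(2,3)]] that by (simp add: norm_dist_def)
qed

definition norm_topology ::
    "('x \<Rightarrow> real ^ 'd) set \<Rightarrow> (('x \<Rightarrow> real ^ 'd) \<Rightarrow> real) \<Rightarrow> ('x \<Rightarrow> real ^ 'd) topology" where
  "norm_topology B N = Metric_space.mtopology B (norm_dist B N)"

definition vector_rkbs ::
    "('x \<Rightarrow> real ^ 'd) set \<Rightarrow> (('x \<Rightarrow> real ^ 'd) \<Rightarrow> real) \<Rightarrow> bool" where
  "vector_rkbs B N \<longleftrightarrow>
     normed_fun_space B N \<and>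
     Metric_space.mcomplete B (norm_dist B N) \<and>
     (\<forall>x. continuous_map (norm_topology B N) euclidean (\<lambda>f. f x))"

definition bilinear_form_on ::
    "('x \<Rightarrow> real ^ 'd) set \<Rightarrow> ('x \<Rightarrow> real ^ 'd) set \<Rightarrow>
     (('x \<Rightarrow> real ^ 'd) \<Rightarrow> ('x \<Rightarrow> real ^ 'd) \<Rightarrow> real) \<Rightarrow> bool" where
  "bilinear_form_on B B' \<phi> \<longleftrightarrow>
     (\<forall>f\<in>B. \<forall>f'\<in>B. \<forall>g\<in>B'. \<phi> (\<lambda>x. f x + f' x) g = \<phi> f g + \<phi> f' g) \<and>
     (\<forall>a. \<forall>f\<in>B. \<forall>g\<in>B'. \<phi> (\<lambda>x. a *\<^sub>R f x) g = a * \<phi> f g) \<and>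
     (\<forall>f\<in>B. \<forall>g\<in>B'. \<forall>g'\<in>B'. \<phi> f (\<lambda>x. g x + g' x) = \<phi> f g + \<phi> f g') \<and>
     (\<forall>a. \<forall>f\<in>B. \<forall>g\<in>B'. \<phi> f (\<lambda>x. a *\<^sub>R g x) = a * \<phi> f g)"

definition reproducing_kernel ::
    "('x \<Rightarrow> 'x \<Rightarrow> real ^ 'd ^ 'd) \<Rightarrow> ('x \<Rightarrow> real ^ 'd) set \<Rightarrow> ('x \<Rightarrow> real ^ 'd) set \<Rightarrow>
     (('x \<Rightarrow> real ^ 'd) \<Rightarrow> ('x \<Rightarrow> real ^ 'd) \<Rightarrow> real) \<Rightarrow> bool" where
  "reproducing_kernel K B B' \<phi> \<longleftrightarrow>
     (\<forall>x c. (\<lambda>t. K t x *v c) \<in> B' \<and>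
            (\<lambda>t. K x t *v c) \<in> B \<and>
            (\<forall>f\<in>B. \<phi> f (\<lambda>t. K t x *v c) = f x \<bullet> c) \<and>
            (\<forall>g\<in>B'. \<phi> (\<lambda>t. K x t *v c) g = c \<bullet> g x))"

definition rkbs_pair ::
    "('x \<Rightarrow> 'x \<Rightarrow> real ^ 'd ^ 'd) \<Rightarrow>
     ('x \<Rightarrow> real ^ 'd) set \<Rightarrow> (('x \<Rightarrow> real ^ 'd) \<Rightarrow> real) \<Rightarrow>
     ('x \<Rightarrow> real ^ 'd) set \<Rightarrow> (('x \<Rightarrow> real ^ 'd) \<Rightarrow> real) \<Rightarrow>
     (('x \<Rightarrow> real ^ 'd) \<Rightarrow> ('x \<Rightarrow> real ^ 'd) \<Rightarrow> real) \<Rightarrow> bool" where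
  "rkbs_pair K B N B' N' \<phi> \<longleftrightarrow>
     vector_rkbs B N \<and>
     vector_rkbs B' N' \<and>
     bilinear_form_on B B' \<phi> \<and>
     continuous_map (prod_topology (norm_topology B N) (norm_topology B' N')) euclidean
       (\<lambda>(f, g). \<phi> f g) \<and>
     reproducing_kernel K B B' \<phi>"


section \<open>The spaces and the bilinear form of an admissible kernel\<close>

definition kernel_series ::
    "('x \<Rightarrow> 'x \<Rightarrow> real ^ 'd ^ 'd) \<Rightarrow> ('x \<Rightarrow> real ^ 'd) \<Rightarrow> 'x \<Rightarrow> real ^ 'd" where
  "kernel_series K c = (\<lambda>y. \<Sum>\<^sub>\<infinity>x\<in>{x. c x \<noteq> 0}. K x y *v c x)"

definition BK :: "('x \<Rightarrow> 'x \<Rightarrow> real ^ 'd ^ 'd) \<Rightarrow> ('x \<Rightarrow> real ^ 'd) set" where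
  "BK K = {kernel_series K c | c. c \<in> l1d}"

text \<open>For an admissible kernel the coefficients \<open>c\<close> are determined by the function.\<close>

definition BK_norm :: "('x \<Rightarrow> 'x \<Rightarrow> real ^ 'd ^ 'd) \<Rightarrow> ('x \<Rightarrow> real ^ 'd) \<Rightarrow> real" where
  "BK_norm K f = (THE r. \<exists>c\<in>l1d. f = kernel_series K c \<and> r = l1d_norm c)"

definition left_sum ::
    "('x \<Rightarrow> 'x \<Rightarrow> real ^ 'd ^ 'd) \<Rightarrow> nat \<Rightarrow> (nat \<Rightarrow> 'x) \<Rightarrow> (nat \<Rightarrow> real ^ 'd) \<Rightarrow>
     'x \<Rightarrow> real ^ 'd" where
  "left_sum K m x c = (\<lambda>t. \<Sum>j<m. K (x j) t *v c j)"

definition right_sum ::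
    "('x \<Rightarrow> 'x \<Rightarrow> real ^ 'd ^ 'd) \<Rightarrow> nat \<Rightarrow> (nat \<Rightarrow> 'x) \<Rightarrow> (nat \<Rightarrow> real ^ 'd) \<Rightarrow>
     'x \<Rightarrow> real ^ 'd" where
  "right_sum K n s b = (\<lambda>t. \<Sum>k<n. K t (s k) *v b k)"

definition B0 :: "('x \<Rightarrow> 'x \<Rightarrow> real ^ 'd ^ 'd) \<Rightarrow> ('x \<Rightarrow> real ^ 'd) set" where
  "B0 K = {left_sum K m x c | m x c. m \<ge> 1}"

definition B0_sharp :: "('x \<Rightarrow> 'x \<Rightarrow> real ^ 'd ^ 'd) \<Rightarrow> ('x \<Rightarrow> real ^ 'd) set" where
  "B0_sharp K = {right_sum K n s b | n s b. n \<ge> 1}"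

definition sup_norm :: "('x \<Rightarrow> real ^ 'd) \<Rightarrow> real" where
  "sup_norm g = (SUP t. infnorm (g t))"

definition BK_sharp :: "('x \<Rightarrow> 'x \<Rightarrow> real ^ 'd ^ 'd) \<Rightarrow> ('x \<Rightarrow> real ^ 'd) set" where
  "BK_sharp K = {g. \<exists>h. (\<forall>n. h n \<in> B0_sharp K) \<and>
     (\<forall>\<epsilon>>0. \<exists>M. \<forall>m\<ge>M. \<forall>n\<ge>M. sup_norm (\<lambda>t. h m t - h n t) < \<epsilon>) \<and>
     (\<forall>t. (\<lambda>n. h n t) \<longlonglongrightarrow> g t)}"

definition form0 ::
    "('x \<Rightarrow> 'x \<Rightarrow> real ^ 'd ^ 'd) \<Rightarrow> ('x \<Rightarrow> real ^ 'd) \<Rightarrow> ('x \<Rightarrow> real ^ 'd) \<Rightarrow> real" where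
  "form0 K f g = (THE r. \<exists>m\<ge>1. \<exists>x c. \<exists>n\<ge>1. \<exists>s b.
     f = left_sum K m x c \<and> g = right_sum K n s b \<and>
     r = (\<Sum>k<n. \<Sum>j<m. c j \<bullet> (K (x j) (s k) *v b k)))"

text \<open>The continuous extension of \<^const>\<open>form0\<close>: the common limit of its values along all
  sequences in \<open>B0 K\<close> and \<open>B0_sharp K\<close> that converge in norm to \<open>f\<close> and \<open>g\<close>.\<close>

definition BK_form ::
    "('x \<Rightarrow> 'x \<Rightarrow> real ^ 'd ^ 'd) \<Rightarrow> ('x \<Rightarrow> real ^ 'd) \<Rightarrow> ('x \<Rightarrow> real ^ 'd) \<Rightarrow> real" where
  "BK_form K f g = (THE r. \<forall>F G.
     (\<forall>n. F n \<in> B0 K) \<and> (\<lambda>n. BK_norm K (\<lambda>t. F n t - f t)) \<longlonglongrightarrow> 0 \<and>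
     (\<forall>n. G n \<in> B0_sharp K) \<and> (\<lambda>n. sup_norm (\<lambda>t. G n t - g t)) \<longlonglongrightarrow> 0 \<longrightarrow>
     (\<lambda>n. form0 K (F n) (G n)) \<longlonglongrightarrow> r)"

end

theory Submission
  imports Defs
begin

text \<open>
  By admissibility, \<open>c \<mapsto> \<Sum>\<^sub>x K(x,\<cdot>) c\<^sub>x\<close> is injective on \<open>\<ell>\<^sup>1\<close>, so that \<open>BK\<close> is an isometric copy
  of \<open>\<ell>\<^sup>1\<close>, while \<open>BK_sharp\<close> is the uniform closure of \<open>B0_sharp\<close> among bounded functions. On these
  spaces the bilinear form is the \<open>\<ell>\<^sup>1\<close>-\<open>\<ell>\<^sup>\<infinity>\<close> duality \<open>(f, g) = \<Sum>\<^sub>x c\<^sub>x \<bullet> g(x)\<close>, where \<open>c\<close> are the coefficients of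
  \<open>f\<close>: the two sides agree on finite sums, and the duality is continuous. Both reproducing
  properties can be read off this formula, the first one by symmetry of the kernel values.
\<close>

section \<open>The \<open>\<ell>\<^sup>1\<close> norm and the space \<open>l1d\<close>\<close>

text \<open>\<open>BK_norm\<close>, \<open>form0\<close> and \<open>BK_form\<close> are definite
  descriptions, so each carries information only once exactly one value is shown to fit. For the
  first two this rests on uniqueness of the coefficients: it makes the norm independent of the
  representation, and it lets the double sum in \<open>form0\<close> be rewritten as
  \<open>l1d_pairing a g\<close>, in which no representation by finite sums occurs.
  \<open>BK_form\<close> needs two things besides: a common limit along all approximating sequences,
  and the existence of at least one such sequence for each argument, since otherwise every real
  would qualify. One estimate, \<open>abs_l1d_pairing_diff_le\<close>, gives both the common limit
  and the joint continuity. Similarly, \<open>sup_norm\<close> is a supremum of reals and says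
  nothing about unbounded functions, hence the boundedness side conditions.\<close>

lemma l1norm_nonneg [simp]: "0 \<le> l1norm v"
  by (simp add: l1norm_def sum_nonneg)

lemma l1norm_zero [simp]: "l1norm 0 = 0"
  by (simp add: l1norm_def)

lemma l1norm_eq_0_iff [simp]: "l1norm v = 0 \<longleftrightarrow> v = 0"
  by (simp add: l1norm_def sum_nonneg_eq_0_iff Finite_Cartesian_Product.vec_eq_iff)

lemma l1norm_scaleR [simp]: "l1norm (a *\<^sub>R v) = \<bar>a\<bar> * l1norm v"
  by (simp add: l1norm_def abs_mult sum_distrib_left)

lemma l1norm_triangle: "l1norm (v + w) \<le> l1norm v + l1norm w"
  unfolding l1norm_def sum.distrib[symmetric]
  by (intro sum_mono) (simp add: abs_triangle_ineq)

lemma norm_le_l1norm: "norm v \<le> l1norm v"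
  by (simp add: l1norm_def norm_le_l1_cart)

lemma infnorm_le_l1norm: "infnorm v \<le> l1norm v"
  using infnorm_le_norm norm_le_l1norm order_trans by blast

text \<open>Hoelder's inequality for the exponents 1 and infinity. It is why coefficients are
  measured by \<open>l1norm\<close> and the second space by \<open>infnorm\<close>.\<close>

lemma abs_inner_le_l1norm_infnorm: "\<bar>v \<bullet> w\<bar> \<le> l1norm v * infnorm w"
proof -
  have "\<bar>v \<bullet> w\<bar> \<le> (\<Sum>i\<in>UNIV. \<bar>v $ i\<bar> * \<bar>w $ i\<bar>)"
    unfolding inner_vec_def by (rule order_trans[OF sum_abs]) (simp add: abs_mult)
  also have "\<dots> \<le> (\<Sum>i\<in>UNIV. \<bar>v $ i\<bar> * infnorm w)"
    by (intro sum_mono mult_left_mono component_le_infnorm_cart) simp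
  finally show ?thesis
    by (simp add: l1norm_def sum_distrib_right)
qed

lemma tendsto_l1norm [tendsto_intros]:
  "(f \<longlongrightarrow> v) F \<Longrightarrow> ((\<lambda>x. l1norm (f x)) \<longlongrightarrow> l1norm v) F"
  unfolding l1norm_def by (intro tendsto_intros)

lemma l1norm_matrix_vector_le:
  fixes A :: "real ^ 'd ^ 'd"
  shows "l1norm (A *v v) \<le> l1_onorm A * l1norm v"
proof (cases "v = 0")
  case False
  \<comment> \<open>The sum of all entries certifies that the quotients are bounded above; without
    this the supremum defining \<open>l1_onorm\<close> would say nothing.\<close>
  define C where "C = (\<Sum>i\<in>UNIV. \<Sum>j\<in>UNIV. \<bar>A $ i $ j\<bar>)"
  have "l1norm (A *v w) / l1norm w \<le> C" for w
  proof -
    have "\<bar>w $ j\<bar> \<le> l1norm w" for j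
      unfolding l1norm_def by (rule member_le_sum) auto
    then have *: "\<bar>A $ i $ j * w $ j\<bar> \<le> \<bar>A $ i $ j\<bar> * l1norm w" for i j
      by (simp add: abs_mult mult_left_mono)
    have "l1norm (A *v w) \<le> (\<Sum>i\<in>UNIV. \<Sum>j\<in>UNIV. \<bar>A $ i $ j * w $ j\<bar>)"
      unfolding l1norm_def matrix_vector_mult_def by (auto intro!: sum_mono)
    also have "\<dots> \<le> (\<Sum>i\<in>UNIV. \<Sum>j\<in>UNIV. \<bar>A $ i $ j\<bar> * l1norm w)"
      by (intro sum_mono *)
    also have "\<dots> = C * l1norm w"
      by (simp add: C_def sum_distrib_right)
    finally have *: "l1norm (A *v w) \<le> C * l1norm w" .
    have "C \<ge> 0"
      unfolding C_def by (intro sum_nonneg) simp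
    then show ?thesis
      using * by (cases "w = 0") (simp_all add: divide_le_eq order_less_le)
  qed
  then have "bdd_above (range (\<lambda>w. l1norm (A *v w) / l1norm w))"
    by (intro bdd_aboveI[of _ C]) auto
  then have "l1norm (A *v v) / l1norm v \<le> l1_onorm A"
    unfolding l1_onorm_def by (intro cSUP_upper) auto
  then show ?thesis
    using False by (simp add: divide_le_eq order_less_le)
qed simp

section \<open>Absolutely summable coefficient families\<close>

lemma l1dD: "c \<in> l1d \<Longrightarrow> (\<lambda>t. l1norm (c t)) summable_on A"
  unfolding l1d_def using summable_on_subset_banach by blast

lemma l1norm_le_l1d_norm:
  assumes "c \<in> l1d"
  shows "l1norm (c t) \<le> l1d_norm c"
  using finite_sum_le_infsum[OF l1dD[OF assms], of "{t}" UNIV] by (simp add: l1d_norm_def)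

lemma sum_l1norm_le_l1d_norm:
  assumes "c \<in> l1d" "finite S"
  shows "(\<Sum>t\<in>S. l1norm (c t)) \<le> l1d_norm c"
  using finite_sum_le_infsum[OF l1dD[OF assms(1)] assms(2)] by (simp add: l1d_norm_def)

text \<open>For nonnegative terms the unordered sum is the supremum of the finite partial sums, so
  one bound on the latter yields membership and the norm estimate together. The triangle inequality
  and completeness are obtained this way.\<close>

lemma l1d_boundedI:
  assumes "\<And>S. finite S \<Longrightarrow> (\<Sum>t\<in>S. l1norm (c t)) \<le> b"
  shows "c \<in> l1d" "l1d_norm c \<le> b"
proof -
  have "(\<lambda>t. l1norm (c t)) summable_on UNIV"
    using assms by (intro nonneg_bdd_above_summable_on bdd_aboveI[of _ b]) auto
  then show "c \<in> l1d" "l1d_norm c \<le> b"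
    using assms by (auto simp: l1d_def l1d_norm_def intro!: infsum_le_finite_sums)
qed

lemma l1d_finite_support:
  assumes "finite S" "\<And>t. t \<notin> S \<Longrightarrow> c t = 0"
  shows "c \<in> l1d" "l1d_norm c = (\<Sum>t\<in>S. l1norm (c t))"
proof -
  have "((\<lambda>t. l1norm (c t)) has_sum (\<Sum>t\<in>S. l1norm (c t))) UNIV"
    by (rule has_sum_finite_neutralI[OF assms(1)]) (use assms in auto)
  then show "c \<in> l1d" "l1d_norm c = (\<Sum>t\<in>S. l1norm (c t))"
    unfolding l1d_def l1d_norm_def by (auto simp: infsumI has_sum_imp_summable)
qed

lemma normed_fun_space_l1d: "normed_fun_space l1d l1d_norm"
  unfolding normed_fun_space_def
proof (intro conjI ballI allI)
  show "(\<lambda>x. 0) \<in> l1d"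
    by (simp add: l1d_def)
  fix f g :: "'a \<Rightarrow> real ^ 'b" and a
  assume f: "f \<in> l1d"
  have "(\<Sum>t\<in>S. l1norm (f t + g t)) \<le> l1d_norm f + l1d_norm g" if "finite S" "g \<in> l1d" for S
  proof -
    have "(\<Sum>t\<in>S. l1norm (f t + g t)) \<le> (\<Sum>t\<in>S. l1norm (f t)) + (\<Sum>t\<in>S. l1norm (g t))"
      unfolding sum.distrib[symmetric] by (intro sum_mono l1norm_triangle)
    also have "\<dots> \<le> l1d_norm f + l1d_norm g"
      using f that by (intro add_mono sum_l1norm_le_l1d_norm)
    finally show ?thesis .
  qed
  then show "(\<lambda>x. f x + g x) \<in> l1d" "l1d_norm (\<lambda>x. f x + g x) \<le> l1d_norm f + l1d_norm g"
    if "g \<in> l1d"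
    using that l1d_boundedI[of "\<lambda>x. f x + g x" "l1d_norm f + l1d_norm g"] by auto
  show "(\<lambda>x. a *\<^sub>R f x) \<in> l1d"
    using f by (simp add: l1d_def summable_on_cmult_right)
  show "l1d_norm (\<lambda>x. a *\<^sub>R f x) = \<bar>a\<bar> * l1d_norm f"
    by (simp add: l1d_norm_def infsum_cmult_right')
  show "0 \<le> l1d_norm f"
    by (simp add: l1d_norm_def infsum_nonneg)
  have "f x = 0" if "l1d_norm f = 0" for x
    using l1norm_le_l1d_norm[OF f, of x] that l1norm_nonneg[of "f x"] l1norm_eq_0_iff[of "f x"] by linarith
  then show "l1d_norm f = 0 \<longleftrightarrow> (\<forall>x. f x = 0)"
    by (auto simp: l1d_norm_def)
qed

lemma normed_fun_spaceD:
  assumes "normed_fun_space B N"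
  shows "(\<lambda>x. 0) \<in> B"
    and "\<And>f g. f \<in> B \<Longrightarrow> g \<in> B \<Longrightarrow> (\<lambda>x. f x + g x) \<in> B"
    and "\<And>a f. f \<in> B \<Longrightarrow> (\<lambda>x. a *\<^sub>R f x) \<in> B"
    and "\<And>f. f \<in> B \<Longrightarrow> 0 \<le> N f"
    and "\<And>f. f \<in> B \<Longrightarrow> N f = 0 \<longleftrightarrow> (\<forall>x. f x = 0)"
    and "\<And>a f. f \<in> B \<Longrightarrow> N (\<lambda>x. a *\<^sub>R f x) = \<bar>a\<bar> * N f"
    and "\<And>f g. f \<in> B \<Longrightarrow> g \<in> B \<Longrightarrow> N (\<lambda>x. f x + g x) \<le> N f + N g"
  using assms unfolding normed_fun_space_def by simp_all

lemma normed_fun_space_diff: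
  assumes "normed_fun_space B N" "f \<in> B" "g \<in> B"
  shows "(\<lambda>x. f x - g x) \<in> B"
  using normed_fun_spaceD(2)[OF assms(1,2) normed_fun_spaceD(3)[OF assms(1,3), of "-1"]] by simp

text \<open>A Fatou argument on finite sets: there the Cauchy estimate passes to the pointwise limit
  term by term, and \<open>l1d_boundedI\<close> restores the full sum.\<close>

lemma l1d_complete:
  fixes \<sigma> :: "nat \<Rightarrow> 't \<Rightarrow> real ^ 'd"
  assumes \<sigma>: "\<And>n. \<sigma> n \<in> l1d"
    and Cauchy: "\<And>e. e > 0 \<Longrightarrow> \<exists>M. \<forall>m\<ge>M. \<forall>n\<ge>M. l1d_norm (\<lambda>t. \<sigma> m t - \<sigma> n t) < e"
  shows "\<exists>c\<in>l1d. (\<lambda>n. l1d_norm (\<lambda>t. \<sigma> n t - c t)) \<longlonglongrightarrow> 0"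
proof -
  note diff = normed_fun_space_diff[OF normed_fun_space_l1d]
  have "Cauchy (\<lambda>n. \<sigma> n t)" for t
  proof (rule metric_CauchyI)
    fix e :: real assume "e > 0"
    then obtain M where "\<forall>m\<ge>M. \<forall>n\<ge>M. l1d_norm (\<lambda>t. \<sigma> m t - \<sigma> n t) < e"
      using Cauchy by blast
    moreover have "dist (\<sigma> m t) (\<sigma> n t) \<le> l1d_norm (\<lambda>t. \<sigma> m t - \<sigma> n t)" for m n
      using norm_le_l1norm[of "\<sigma> m t - \<sigma> n t"] l1norm_le_l1d_norm[OF diff[OF \<sigma>[of m] \<sigma>[of n]], of t]
      by (simp add: dist_norm)
    ultimately show "\<exists>M. \<forall>m\<ge>M. \<forall>n\<ge>M. dist (\<sigma> m t) (\<sigma> n t) < e"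
      by (meson order_le_less_trans)
  qed
  then obtain c where c: "\<And>t. (\<lambda>n. \<sigma> n t) \<longlonglongrightarrow> c t"
    unfolding Cauchy_convergent_iff convergent_def by metis
  \<comment> \<open>Membership is part of the claim because \<open>c\<close> is not yet known to lie
    in \<open>l1d\<close>.\<close>
  have close: "\<exists>M. \<forall>n\<ge>M. (\<lambda>t. \<sigma> n t - c t) \<in> l1d \<and> l1d_norm (\<lambda>t. \<sigma> n t - c t) \<le> e"
    if "e > 0" for e
  proof -
    obtain M where M: "\<forall>m\<ge>M. \<forall>n\<ge>M. l1d_norm (\<lambda>t. \<sigma> m t - \<sigma> n t) < e"
      using Cauchy \<open>e > 0\<close> by blast
    have "(\<Sum>t\<in>S. l1norm (\<sigma> n t - c t)) \<le> e" if "n \<ge> M" "finite S" for n S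
    proof (rule tendsto_upperbound)
      show "(\<lambda>m. \<Sum>t\<in>S. l1norm (\<sigma> n t - \<sigma> m t)) \<longlonglongrightarrow> (\<Sum>t\<in>S. l1norm (\<sigma> n t - c t))"
        by (intro tendsto_intros c)
      have "(\<Sum>t\<in>S. l1norm (\<sigma> n t - \<sigma> m t)) \<le> e" if "m \<ge> M" for m
        using sum_l1norm_le_l1d_norm[OF diff[OF \<sigma>[of n] \<sigma>[of m]] \<open>finite S\<close>] M \<open>n \<ge> M\<close> that
        by fastforce
      then show "\<forall>\<^sub>F m in sequentially. (\<Sum>t\<in>S. l1norm (\<sigma> n t - \<sigma> m t)) \<le> e"
        by (auto simp: eventually_sequentially)
    qed simp
    then show ?thesis
      using l1d_boundedI[of "\<lambda>t. \<sigma> n t - c t" e for n] by metis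
  qed
  obtain n where n: "(\<lambda>t. \<sigma> n t - c t) \<in> l1d"
    using close[of 1] by auto
  \<comment> \<open>\<open>c\<close> is the difference of the summable families
    \<open>\<sigma> n\<close> and \<open>\<sigma> n - c\<close>.\<close>
  have "c \<in> l1d"
    using diff[OF \<sigma>[of n] n] by simp
  moreover have "(\<lambda>n. l1d_norm (\<lambda>t. \<sigma> n t - c t)) \<longlonglongrightarrow> 0"
  proof (rule LIMSEQ_I)
    fix e :: real assume "e > 0"
    then obtain M where M: "\<forall>n\<ge>M. l1d_norm (\<lambda>t. \<sigma> n t - c t) \<le> e / 2"
      using close[of "e / 2"] by auto
    have "l1d_norm (\<lambda>t. \<sigma> n t - c t) \<ge> 0" for n
      by (simp add: l1d_norm_def infsum_nonneg)
    with M \<open>e > 0\<close> show "\<exists>M. \<forall>n\<ge>M. norm (l1d_norm (\<lambda>t. \<sigma> n t - c t) - 0) < e"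
      by (intro exI[of _ M]) fastforce
  qed
  ultimately show ?thesis
    by blast
qed

lemma l1d_finite_approx:
  assumes c: "c \<in> l1d" and "e > 0"
  shows "\<exists>S. finite S \<and> S \<noteq> {} \<and> l1d_norm (\<lambda>t. (if t \<in> S then c t else 0) - c t) < e"
proof -
  have sums: "((\<lambda>t. l1norm (c t)) has_sum l1d_norm c) UNIV"
    using c by (simp add: l1d_def l1d_norm_def)
  have "\<forall>\<^sub>F S in finite_subsets_at_top UNIV. dist (\<Sum>t\<in>S. l1norm (c t)) (l1d_norm c) < e"
    using sums \<open>e > 0\<close> unfolding has_sum_def by (rule tendstoD)
  then obtain S0 where S0: "finite S0"
    "\<And>S. finite S \<Longrightarrow> S0 \<subseteq> S \<Longrightarrow> dist (\<Sum>t\<in>S. l1norm (c t)) (l1d_norm c) < e"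
    unfolding eventually_finite_subsets_at_top by auto
  \<comment> \<open>\<open>B0\<close> asks for at least one term, so the set must be nonempty even
    if \<open>c\<close> vanishes. Any point will do, since the estimate holds for every finite
    superset of \<open>S0\<close>.\<close>
  define S where "S = insert undefined S0"
  have S: "finite S" "S \<noteq> {}" "dist (\<Sum>t\<in>S. l1norm (c t)) (l1d_norm c) < e"
    using S0 by (auto simp: S_def)
  have "l1d_norm (\<lambda>t. (if t \<in> S then c t else 0) - c t) = (\<Sum>\<^sub>\<infinity>t\<in>UNIV - S. l1norm (c t))"
    unfolding l1d_norm_def by (rule infsum_cong_neutral) (auto simp: l1norm_def)
  also have "\<dots> = l1d_norm c - (\<Sum>t\<in>S. l1norm (c t))"
    using S(1) c by (subst infsum_Diff) (auto simp: l1d_def l1d_norm_def)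
  also have "\<dots> < e"
    using S(3) by (simp add: dist_real_def)
  finally show ?thesis
    using S(1,2) by (intro exI[of _ S] conjI)
qed

section \<open>The supremum norm and the pairing with \<open>l1d\<close>\<close>

lemma infnorm_le_sup_norm:
  assumes "bounded (range g)"
  shows "infnorm (g t) \<le> sup_norm g"
proof -
  obtain b where "\<And>t. norm (g t) \<le> b"
    using assms by (auto simp: bounded_iff)
  then have "bdd_above (range (\<lambda>t. infnorm (g t)))"
    by (intro bdd_aboveI[of _ b]) (auto intro: order_trans[OF infnorm_le_norm])
  then show ?thesis
    unfolding sup_norm_def by (intro cSUP_upper) auto
qed

lemma sup_norm_least: "(\<And>t. infnorm (g t) \<le> b) \<Longrightarrow> sup_norm g \<le> b"
  unfolding sup_norm_def by (intro cSUP_least) auto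

text \<open>The Euclidean norm exceeds the maximum norm by at most the factor
  \<open>sqrt DIM(real ^ 'd)\<close>. The same factor reappears wherever an estimate in
  \<open>infnorm\<close> has to yield one in the ambient norm.\<close>

lemma bounded_range_infnormI:
  fixes g :: "'x \<Rightarrow> real ^ 'd"
  assumes "\<And>t. infnorm (g t) \<le> b"
  shows "bounded (range g)"
proof -
  have "norm (g t) \<le> sqrt DIM(real ^ 'd) * b" for t
    using assms by (intro order_trans[OF norm_le_infnorm] mult_left_mono) auto
  then show ?thesis
    by (auto simp: bounded_iff)
qed

lemma bounded_range_add:
  fixes f g :: "'x \<Rightarrow> real ^ 'd"
  assumes "bounded (range f)" "bounded (range g)"
  shows "bounded (range (\<lambda>t. f t + g t))"
proof (rule bounded_range_infnormI)
  show "infnorm (f t + g t) \<le> sup_norm f + sup_norm g" for t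
    using infnorm_le_sup_norm[OF assms(1), of t] infnorm_le_sup_norm[OF assms(2), of t]
      infnorm_triangle[of "f t" "g t"] by linarith
qed

lemma bounded_range_scaleR:
  fixes f :: "'x \<Rightarrow> real ^ 'd"
  assumes "bounded (range f)"
  shows "bounded (range (\<lambda>t. a *\<^sub>R f t))"
  by (rule bounded_range_infnormI[of _ "\<bar>a\<bar> * sup_norm f"])
    (simp add: infnorm_mul mult_left_mono infnorm_le_sup_norm[OF assms])

lemma bounded_range_diff:
  fixes f g :: "'x \<Rightarrow> real ^ 'd"
  assumes "bounded (range f)" "bounded (range g)"
  shows "bounded (range (\<lambda>t. f t - g t))"
  using bounded_range_add[OF assms(1) bounded_range_scaleR[OF assms(2), of "-1"]] by simp

lemma sup_norm_nonneg: "bounded (range g) \<Longrightarrow> 0 \<le> sup_norm g"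
  by (rule order_trans[OF infnorm_pos_le infnorm_le_sup_norm])

lemma sup_norm_triangle:
  assumes "bounded (range f)" "bounded (range g)"
  shows "sup_norm (\<lambda>t. f t + g t) \<le> sup_norm f + sup_norm g"
proof (rule sup_norm_least)
  show "infnorm (f t + g t) \<le> sup_norm f + sup_norm g" for t
    using infnorm_le_sup_norm[OF assms(1), of t] infnorm_le_sup_norm[OF assms(2), of t]
      infnorm_triangle[of "f t" "g t"] by linarith
qed

lemma normed_fun_space_sup_norm:
  fixes B :: "('x \<Rightarrow> real ^ 'd) set"
  assumes bdd: "\<And>g. g \<in> B \<Longrightarrow> bounded (range g)"
    and zero: "(\<lambda>x. 0) \<in> B"
    and add: "\<And>f g. f \<in> B \<Longrightarrow> g \<in> B \<Longrightarrow> (\<lambda>x. f x + g x) \<in> B"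
    and scale: "\<And>a f. f \<in> B \<Longrightarrow> (\<lambda>x. a *\<^sub>R f x) \<in> B"
  shows "normed_fun_space B sup_norm"
  unfolding normed_fun_space_def
proof (intro conjI ballI allI)
  fix f a assume f: "f \<in> B"
  have "f x = 0" if "sup_norm f = 0" for x
    using infnorm_le_sup_norm[OF bdd[OF f], of x] that infnorm_eq_0[of "f x"] infnorm_pos_le[of "f x"]
    by linarith
  moreover have "sup_norm f = 0" if "\<forall>x. f x = 0"
    using that by (simp add: sup_norm_def infnorm_0)
  ultimately show "sup_norm f = 0 \<longleftrightarrow> (\<forall>x. f x = 0)"
    by blast
  \<comment> \<open>Stated for every \<open>h\<close> in \<open>B\<close> so that it can be used
    twice: with \<open>a\<close> on \<open>f\<close>, and with \<open>inverse a\<close> on the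
    multiple of \<open>f\<close> by \<open>a\<close>, which gives the reverse inequality.\<close>
  have le: "sup_norm (\<lambda>x. b *\<^sub>R h x) \<le> \<bar>b\<bar> * sup_norm h" if "h \<in> B" for b h
    by (rule sup_norm_least)
      (simp add: infnorm_mul mult_left_mono infnorm_le_sup_norm[OF bdd[OF that]])
  show "sup_norm (\<lambda>x. a *\<^sub>R f x) = \<bar>a\<bar> * sup_norm f"
  proof (cases "a = 0")
    case False
    then have "\<bar>a\<bar> * sup_norm f \<le> sup_norm (\<lambda>x. a *\<^sub>R f x)"
      using le[OF scale[OF f, of a], of "inverse a"] by (simp add: field_simps)
    then show ?thesis
      using le[OF f, of a] by simp
  qed (simp add: sup_norm_def infnorm_0)
  show "0 \<le> sup_norm f"
    by (rule sup_norm_nonneg[OF bdd[OF f]])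
  show "(\<lambda>x. a *\<^sub>R f x) \<in> B"
    by (rule scale[OF f])
  fix g assume g: "g \<in> B"
  show "(\<lambda>x. f x + g x) \<in> B"
    by (rule add[OF f g])
  show "sup_norm (\<lambda>x. f x + g x) \<le> sup_norm f + sup_norm g"
    by (rule sup_norm_triangle[OF bdd[OF f] bdd[OF g]])
qed (rule zero)

lemma tendsto_infnormI:
  fixes v :: "real ^ 'd"
  assumes "(\<lambda>n. infnorm (f n - v)) \<longlonglongrightarrow> 0"
  shows "f \<longlonglongrightarrow> v"
proof (rule Lim_transform_bound[THEN LIM_zero_cancel])
  show "\<forall>\<^sub>F n in sequentially. norm (f n - v) \<le> norm (sqrt DIM(real ^ 'd) * infnorm (f n - v))"
    using norm_le_infnorm[of "f _ - v"] by (intro always_eventually allI) (simp add: abs_mult real_abs_infnorm)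
  show "(\<lambda>n. sqrt DIM(real ^ 'd) * infnorm (f n - v)) \<longlonglongrightarrow> 0"
    using tendsto_mult_left[OF assms] by simp
qed

lemma tendsto_0_le_inverse_Suc:
  fixes f :: "nat \<Rightarrow> real"
  assumes "\<And>n. 0 \<le> f n" "\<And>n. f n \<le> 1 / Suc n"
  shows "f \<longlonglongrightarrow> 0"
proof (rule tendsto_sandwich[of "\<lambda>_. 0" _ _ "\<lambda>n. 1 / Suc n"])
  show "(\<lambda>n. 1 / Suc n) \<longlonglongrightarrow> (0 :: real)"
    using LIMSEQ_inverse_real_of_nat by (simp add: inverse_eq_divide)
qed (use assms in \<open>auto intro!: always_eventually\<close>)

text \<open>The pairing takes coefficients instead of the function that they represent, so it makes
  sense before any uniqueness is known. For \<open>c\<close> in \<open>l1d\<close> and bounded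
  \<open>g\<close> the series converges absolutely.\<close>

definition l1d_pairing :: "('x \<Rightarrow> real ^ 'd) \<Rightarrow> ('x \<Rightarrow> real ^ 'd) \<Rightarrow> real" where
  "l1d_pairing c g = (\<Sum>\<^sub>\<infinity>x. c x \<bullet> g x)"

lemma abs_inner_le_sup_norm:
  assumes "bounded (range g)"
  shows "\<bar>c x \<bullet> g x\<bar> \<le> l1norm (c x) * sup_norm g"
  using abs_inner_le_l1norm_infnorm[of "c x" "g x"]
    mult_left_mono[OF infnorm_le_sup_norm[OF assms, of x], of "l1norm (c x)"] by simp

lemma l1d_pairing_abs_summable:
  assumes "c \<in> l1d" "bounded (range g)"
  shows "(\<lambda>x. norm (c x \<bullet> g x)) summable_on UNIV"
proof (rule Infinite_Sum.abs_summable_on_comparison_test')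
  show "(\<lambda>x. l1norm (c x) * sup_norm g) summable_on UNIV"
    using assms(1) by (simp add: l1d_def summable_on_cmult_left)
qed (simp add: abs_inner_le_sup_norm[OF assms(2)])

lemma l1d_pairing_summable:
  assumes "c \<in> l1d" "bounded (range g)"
  shows "(\<lambda>x. c x \<bullet> g x) summable_on UNIV"
  using Infinite_Sum.abs_summable_summable[OF l1d_pairing_abs_summable[OF assms]] .

lemma abs_l1d_pairing_le:
  assumes "c \<in> l1d" "bounded (range g)"
  shows "\<bar>l1d_pairing c g\<bar> \<le> l1d_norm c * sup_norm g"
proof -
  have "\<bar>l1d_pairing c g\<bar> \<le> (\<Sum>\<^sub>\<infinity>x. \<bar>c x \<bullet> g x\<bar>)"
    using norm_infsum_bound[OF l1d_pairing_abs_summable[OF assms]] by (simp add: l1d_pairing_def)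
  also have "\<dots> \<le> (\<Sum>\<^sub>\<infinity>x. l1norm (c x) * sup_norm g)"
    using l1d_pairing_abs_summable[OF assms] assms(1)
    by (intro infsum_mono abs_inner_le_sup_norm[OF assms(2)])
       (simp_all add: l1d_def summable_on_cmult_left)
  finally show ?thesis
    by (simp add: l1d_norm_def infsum_cmult_left')
qed

lemma l1d_pairing_add_left:
  assumes "c \<in> l1d" "c' \<in> l1d" "bounded (range g)"
  shows "l1d_pairing (\<lambda>x. c x + c' x) g = l1d_pairing c g + l1d_pairing c' g"
  using assms by (simp add: l1d_pairing_def inner_add_left infsum_add l1d_pairing_summable)

lemma l1d_pairing_add_right:
  assumes "c \<in> l1d" "bounded (range g)" "bounded (range g')"
  shows "l1d_pairing c (\<lambda>x. g x + g' x) = l1d_pairing c g + l1d_pairing c g'"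
  using assms by (simp add: l1d_pairing_def inner_add_right infsum_add l1d_pairing_summable)

lemma l1d_pairing_scaleR_left: "l1d_pairing (\<lambda>x. a *\<^sub>R c x) g = a * l1d_pairing c g"
  by (simp add: l1d_pairing_def infsum_cmult_right')

lemma l1d_pairing_scaleR_right: "l1d_pairing c (\<lambda>x. a *\<^sub>R g x) = a * l1d_pairing c g"
  by (simp add: l1d_pairing_def infsum_cmult_right')

lemma l1d_pairing_single: "l1d_pairing (\<lambda>t. if t = x then v else 0) g = v \<bullet> g x"
  unfolding l1d_pairing_def
  by (rule infsumI, rule has_sum_finite_neutralI[of "{x}"]) auto

text \<open>Insert \<open>l1d_pairing c g'\<close> between the two values, then bound
  \<open>sup_norm g'\<close> by the triangle inequality. Only the differences and the norms at the
  base point remain, which is the form that continuity at \<open>(c, g)\<close> requires.\<close>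

lemma abs_l1d_pairing_diff_le:
  assumes "c \<in> l1d" "c' \<in> l1d" "bounded (range g)" "bounded (range g')"
  shows "\<bar>l1d_pairing c' g' - l1d_pairing c g\<bar> \<le>
    l1d_norm (\<lambda>x. c' x - c x) * (sup_norm (\<lambda>x. g' x - g x) + sup_norm g) +
    l1d_norm c * sup_norm (\<lambda>x. g' x - g x)"
proof -
  have bdiff: "bounded (range (\<lambda>x. g' x - g x))"
    by (intro bounded_range_diff assms)
  have cdiff: "(\<lambda>x. c' x - c x) \<in> l1d"
    by (intro normed_fun_space_diff[OF normed_fun_space_l1d] assms)
  have "l1d_pairing c' g' - l1d_pairing c g' = l1d_pairing (\<lambda>x. c' x - c x) g'"
    using l1d_pairing_add_left[OF cdiff assms(1,4)] by simp
  moreover have "l1d_pairing c g' - l1d_pairing c g = l1d_pairing c (\<lambda>x. g' x - g x)"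
    using l1d_pairing_add_right[OF assms(1) bdiff assms(3)] by simp
  moreover have "sup_norm g' \<le> sup_norm (\<lambda>x. g' x - g x) + sup_norm g"
    using sup_norm_triangle[OF bdiff assms(3)] by simp
  then have "l1d_norm (\<lambda>x. c' x - c x) * sup_norm g' \<le>
      l1d_norm (\<lambda>x. c' x - c x) * (sup_norm (\<lambda>x. g' x - g x) + sup_norm g)"
    by (intro mult_left_mono) (simp_all add: l1d_norm_def infsum_nonneg)
  ultimately show ?thesis
    using abs_l1d_pairing_le[OF cdiff assms(4)] abs_l1d_pairing_le[OF assms(1) bdiff] by linarith
qed

section \<open>Completeness and continuity in normed function spaces\<close>

text \<open>Sequences in \<open>B\<close> never meet the guard in \<open>norm_dist\<close>, so
  completeness may be checked with \<open>N\<close> itself.\<close>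

lemma mcomplete_norm_distI:
  fixes B :: "('x \<Rightarrow> real ^ 'd) set"
  assumes nfs: "normed_fun_space B N"
    and lim: "\<And>\<sigma>. (\<And>n. \<sigma> n \<in> B) \<Longrightarrow>
      (\<And>e. e > 0 \<Longrightarrow> \<exists>M. \<forall>m\<ge>M. \<forall>n\<ge>M. N (\<lambda>x. \<sigma> m x - \<sigma> n x) < e) \<Longrightarrow>
      \<exists>g\<in>B. (\<lambda>n. N (\<lambda>x. \<sigma> n x - g x)) \<longlonglongrightarrow> 0"
  shows "Metric_space.mcomplete B (norm_dist B N)"
proof -
  interpret Metric_space B "norm_dist B N"
    by (rule Metric_space_norm_dist[OF nfs])
  show ?thesis
    unfolding mcomplete_def
  proof (intro allI impI)
    fix \<sigma> assume "MCauchy \<sigma>"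
    then have \<sigma>: "\<sigma> n \<in> B" for n
      by (auto simp: MCauchy_def)
    have "\<exists>M. \<forall>m\<ge>M. \<forall>n\<ge>M. N (\<lambda>x. \<sigma> m x - \<sigma> n x) < e" if "e > 0" for e
    proof -
      have "\<exists>M. \<forall>m n. M \<le> m \<longrightarrow> M \<le> n \<longrightarrow> norm_dist B N (\<sigma> m) (\<sigma> n) < e"
        using \<open>MCauchy \<sigma>\<close> that unfolding MCauchy_def by blast
      moreover have "norm_dist B N (\<sigma> m) (\<sigma> n) = N (\<lambda>x. \<sigma> m x - \<sigma> n x)" for m n
        by (simp add: norm_dist_def \<sigma>)
      ultimately show ?thesis
        by simp
    qed
    then have "\<exists>g\<in>B. (\<lambda>n. N (\<lambda>x. \<sigma> n x - g x)) \<longlonglongrightarrow> 0"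
      by (rule lim[OF \<sigma>])
    then obtain g where g: "g \<in> B" "(\<lambda>n. N (\<lambda>x. \<sigma> n x - g x)) \<longlonglongrightarrow> 0"
      by (rule bexE)
    then have "(\<lambda>n. norm_dist B N (\<sigma> n) g) \<longlonglongrightarrow> 0"
      using \<sigma> by (simp add: norm_dist_def)
    then show "\<exists>x. limitin mtopology \<sigma> x sequentially"
      using g \<sigma> by (auto simp: limitin_metric_dist_null)
  qed
qed

lemma continuous_map_evaluation:
  fixes B :: "('x \<Rightarrow> real ^ 'd) set"
  assumes nfs: "normed_fun_space B N"
    and le: "\<And>f. f \<in> B \<Longrightarrow> norm (f x) \<le> C * N f"
  shows "continuous_map (norm_topology B N) euclidean (\<lambda>f. f x)"
proof -
  interpret Metric_space B "norm_dist B N"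
    by (rule Metric_space_norm_dist[OF nfs])
  have "openin mtopology {f \<in> B. f x \<in> U}" if "open U" for U
    unfolding openin_mtopology
  proof (intro conjI allI impI)
    fix f assume f: "f \<in> {f \<in> B. f x \<in> U}"
    then obtain e where e: "e > 0" "ball (f x) e \<subseteq> U"
      using \<open>open U\<close> by (auto simp: open_contains_ball)
    \<comment> \<open>\<open>C\<close> may be zero or negative; \<open>\<bar>C\<bar> + 1\<close> is
      a positive bound for it.\<close>
    have "g x \<in> U" if "g \<in> B" "N (\<lambda>x. f x - g x) < e / (\<bar>C\<bar> + 1)" for g
    proof -
      have fg: "(\<lambda>x. f x - g x) \<in> B"
        using f that by (intro normed_fun_space_diff[OF nfs]) auto
      then have "0 \<le> N (\<lambda>x. f x - g x)"
        by (rule normed_fun_spaceD(4)[OF nfs])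
      then have "C * N (\<lambda>x. f x - g x) \<le> (\<bar>C\<bar> + 1) * N (\<lambda>x. f x - g x)"
        by (intro mult_right_mono) auto
      also have "\<dots> < e"
        using that(2) by (simp add: field_simps)
      finally have "dist (f x) (g x) < e"
        using le[OF fg] by (simp add: dist_norm)
      then show ?thesis
        using e by auto
    qed
    with f e show "\<exists>r>0. mball f r \<subseteq> {f \<in> B. f x \<in> U}"
      by (intro exI[of _ "e / (\<bar>C\<bar> + 1)"]) (auto simp: norm_dist_def)
  qed auto
  then show ?thesis
    by (auto simp: continuous_map_def norm_topology_def)
qed

lemma continuous_map_bilinear_form:
  fixes B B' :: "('x \<Rightarrow> real ^ 'd) set"
  assumes nfs: "normed_fun_space B N" "normed_fun_space B' N'"
    and le: "\<And>f f' g g'. f \<in> B \<Longrightarrow> f' \<in> B \<Longrightarrow> g \<in> B' \<Longrightarrow> g' \<in> B' \<Longrightarrow>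
      \<bar>\<phi> f' g' - \<phi> f g\<bar> \<le>
        N (\<lambda>x. f' x - f x) * (N' (\<lambda>x. g' x - g x) + N' g) + N f * N' (\<lambda>x. g' x - g x)"
  shows "continuous_map (prod_topology (norm_topology B N) (norm_topology B' N')) euclidean
    (\<lambda>(f, g). \<phi> f g :: real)"
proof -
  interpret M: Metric_space B "norm_dist B N"
    by (rule Metric_space_norm_dist[OF nfs(1)])
  interpret M': Metric_space B' "norm_dist B' N'"
    by (rule Metric_space_norm_dist[OF nfs(2)])
  have "openin (prod_topology M.mtopology M'.mtopology) {(f, g) \<in> B \<times> B'. \<phi> f g \<in> U}"
    if "open U" for U
    unfolding openin_prod_topology_alt
  proof (intro allI impI)
    fix f g assume "(f, g) \<in> {(f, g) \<in> B \<times> B'. \<phi> f g \<in> U}"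
    then have fg: "f \<in> B" "g \<in> B'" "\<phi> f g \<in> U"
      by auto
    then obtain e where e: "e > 0" "ball (\<phi> f g) e \<subseteq> U"
      using \<open>open U\<close> by (auto simp: open_contains_ball)
    have pos: "N f \<ge> 0" "N' g \<ge> 0"
      using fg normed_fun_spaceD(4)[OF nfs(1)] normed_fun_spaceD(4)[OF nfs(2)] by auto
    \<comment> \<open>With both distances replaced by \<open>\<delta>\<close>, the bound in
      \<open>le\<close> is a polynomial in \<open>\<delta>\<close> vanishing at 0, so a suitable
      positive radius exists by continuity.\<close>
    have "(\<lambda>\<delta>. \<delta> * (\<delta> + N' g) + N f * \<delta>) \<midarrow>0\<rightarrow> 0 * (0 + N' g) + N f * 0"
      by (intro tendsto_intros)
    then have "((\<lambda>\<delta>. \<delta> * (\<delta> + N' g) + N f * \<delta>) \<longlongrightarrow> 0) (at_right 0)"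
      by (simp add: filterlim_at_split)
    then have "\<forall>\<^sub>F \<delta> in at_right 0. \<delta> * (\<delta> + N' g) + N f * \<delta> < e"
      using e(1) by (rule order_tendstoD)
    then have "\<forall>\<^sub>F \<delta> in at_right 0. \<delta> > 0 \<and> \<delta> * (\<delta> + N' g) + N f * \<delta> < e"
      using eventually_at_right_less by (rule eventually_elim2) auto
    then obtain \<delta> where \<delta>: "\<delta> > 0" "\<delta> * (\<delta> + N' g) + N f * \<delta> < e"
      using eventually_happens'[OF trivial_limit_at_right_real] by blast
    have "\<phi> f' g' \<in> U"
      if "f' \<in> B" "norm_dist B N f f' < \<delta>" "g' \<in> B'" "norm_dist B' N' g g' < \<delta>" for f' g'
    proof -
      have lt: "N (\<lambda>x. f' x - f x) < \<delta>" "N' (\<lambda>x. g' x - g x) < \<delta>"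
        using that(2,4) that(1,3) fg unfolding M.commute[of f f'] M'.commute[of g g']
        by (simp_all add: norm_dist_def)
      have nonneg: "0 \<le> N (\<lambda>x. f' x - f x)" "0 \<le> N' (\<lambda>x. g' x - g x)"
        using that fg normed_fun_spaceD(4)[OF nfs(1) normed_fun_space_diff[OF nfs(1)]]
          normed_fun_spaceD(4)[OF nfs(2) normed_fun_space_diff[OF nfs(2)]] by auto
      have "\<bar>\<phi> f' g' - \<phi> f g\<bar> \<le> \<delta> * (\<delta> + N' g) + N f * \<delta>"
        using le[OF fg(1) that(1) fg(2) that(3)]
      proof (rule order_trans)
        show "N (\<lambda>x. f' x - f x) * (N' (\<lambda>x. g' x - g x) + N' g) + N f * N' (\<lambda>x. g' x - g x)
            \<le> \<delta> * (\<delta> + N' g) + N f * \<delta>"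
          using lt nonneg pos by (intro add_mono mult_mono) auto
      qed
      then have "dist (\<phi> f g) (\<phi> f' g') < e"
        using \<delta>(2) by (simp add: dist_real_def abs_minus_commute)
      then show ?thesis
        using e by auto
    qed
    with fg \<delta>(1) show "\<exists>V W. openin M.mtopology V \<and> openin M'.mtopology W \<and> f \<in> V \<and> g \<in> W \<and>
        V \<times> W \<subseteq> {(f, g) \<in> B \<times> B'. \<phi> f g \<in> U}"
      by (intro exI[of _ "M.mball f \<delta>"] exI[of _ "M'.mball g \<delta>"]) auto
  qed
  moreover have "{(f, g) \<in> B \<times> B'. \<phi> f g \<in> U} = {p \<in> B \<times> B'. (case p of (f, g) \<Rightarrow> \<phi> f g) \<in> U}" for U
    by auto
  ultimately show ?thesis
    by (auto simp: continuous_map_def norm_topology_def)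
qed

section \<open>Uniqueness of the coefficients\<close>

lemma inner_matrix_vector_symmetric:
  fixes A :: "real ^ 'd ^ 'd"
  assumes "Finite_Cartesian_Product.transpose A = A"
  shows "(A *v v) \<bullet> w = v \<bullet> (A *v w)"
proof -
  have "(A *v v) \<bullet> w = (v v* A) \<bullet> w"
    using transpose_matrix_vector[of A v] assms by simp
  also have "\<dots> = v \<bullet> (A *v w)"
    by (rule dot_lmul_matrix)
  finally show ?thesis .
qed

section \<open>Linear algebra of the block kernel matrix\<close>

lemma invertible_mat_mult_vec_eq_0:
  fixes A :: "real mat"
  assumes "invertible_mat A" "A \<in> carrier_mat n n" "v \<in> carrier_vec n" "A *\<^sub>v v = 0\<^sub>v n"
  shows "v = 0\<^sub>v n"
proof -
  obtain B where B: "A * B = 1\<^sub>m (dim_row A)" "B * A = 1\<^sub>m (dim_row B)"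
    using assms(1) by (auto simp: invertible_mat_def inverts_mat_def)
  \<comment> \<open>\<open>invertible_mat\<close> does not state the shape of the inverse; comparing
    column counts in the two identities shows \<open>B\<close> to be \<open>n\<close> by
    \<open>n\<close>.\<close>
  have "dim_col (A * B) = n" "dim_col (B * A) = dim_row B"
    using assms(2) by (simp_all only: B) auto
  then have carrier: "B \<in> carrier_mat n n"
    using assms(2) by auto
  then have "v = (B * A) *\<^sub>v v"
    using assms(3) by (simp add: B(2))
  also have "\<dots> = B *\<^sub>v (A *\<^sub>v v)"
    by (rule assoc_mult_mat_vec[OF carrier assms(2,3)])
  also have "\<dots> = 0\<^sub>v n"
    using carrier unfolding assms(4) by (intro eq_vecI) auto
  finally show ?thesis .
qed

text \<open>The split \<open>q = k * d + i\<close> mirrors the \<open>div\<close> and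
  \<open>mod\<close> addressing in \<open>kernel_matrix\<close>: \<open>k\<close> selects the block
  and \<open>i\<close> the position inside it.\<close>

lemma sum_lessThan_mult:
  fixes f :: "nat \<Rightarrow> 'a :: comm_monoid_add"
  shows "(\<Sum>q<m * d. f q) = (\<Sum>k<m. \<Sum>i<d. f (k * d + i))"
proof -
  have "sum f {k * d..<k * d + d} = (\<Sum>i<d. f (k * d + i))" for k
    using sum.shift_bounds_nat_ivl[of f 0 "k * d" d] by (simp add: lessThan_atLeast0 add.commute)
  then show ?thesis
    using sum.nat_group[of f d m] by simp
qed

lemma sum_from_nat_into_UNIV:
  fixes f :: "'d :: finite \<Rightarrow> 'a :: comm_monoid_add"
  shows "(\<Sum>i<CARD('d). f (from_nat_into UNIV i)) = (\<Sum>i\<in>UNIV. f i)"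
  by (rule sum.reindex_bij_betw) (use bij_betw_from_nat_into_finite[of "UNIV :: 'd set"] in simp)

text \<open>The vector equations at the points \<open>x j\<close> form one homogeneous linear system
  for the flattened coefficients, and an invertible matrix has trivial kernel.\<close>

lemma kernel_matrix_injective:
  fixes K :: "'x \<Rightarrow> 'x \<Rightarrow> real ^ 'd ^ 'd"
  assumes inv: "invertible_mat (kernel_matrix K m x)"
    and zero: "\<And>j. j < m \<Longrightarrow> (\<Sum>k<m. K (x k) (x j) *v c k) = 0"
    and "k < m"
  shows "c k = 0"
proof -
  define d where "d = CARD('d)"
  define e where "e = (from_nat_into UNIV :: nat \<Rightarrow> 'd)"
  define A where "A = kernel_matrix K m x"
  define v where "v = Matrix.vec (m * d) (\<lambda>q. c (q div d) $ e (q mod d))"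
  have "d > 0"
    by (simp add: d_def)
  have A: "A \<in> carrier_mat (m * d) (m * d)"
    by (simp add: A_def kernel_matrix_def Let_def d_def)
  have v: "v \<in> carrier_vec (m * d)"
    by (simp add: v_def)
  have less: "k * d + i < m * d" if "k < m" "i < d" for k i
  proof -
    have "k * d + i < Suc k * d"
      using that by simp
    also have "\<dots> \<le> m * d"
      using that by (intro mult_le_mono1) simp
    finally show ?thesis .
  qed
  have "A *\<^sub>v v = 0\<^sub>v (m * d)"
  proof (rule eq_vecI)
    fix p assume "p < dim_vec (0\<^sub>v (m * d) :: real Matrix.vec)"
    then have p: "p < m * d"
      by simp
    then have j: "p div d < m"
      by (simp add: less_mult_imp_div_less)
    \<comment> \<open>Row \<open>p\<close> of the system is component \<open>e (p mod d)\<close> of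
      the vector equation at the point \<open>x (p div d)\<close>.\<close>
    have "vec_index (A *\<^sub>v v) p =
        (\<Sum>q<m * d. K (x (q div d)) (x (p div d)) $ e (p mod d) $ e (q mod d) * vec_index v q)"
      using A p by (simp add: scalar_prod_def lessThan_atLeast0 v_def)
        (simp add: A_def kernel_matrix_def Let_def d_def e_def)
    also have "\<dots> = (\<Sum>k<m. \<Sum>i<d. K (x k) (x (p div d)) $ e (p mod d) $ e i * c k $ e i)"
      unfolding sum_lessThan_mult using less \<open>d > 0\<close>
      by (intro sum.cong refl) (simp add: v_def)
    also have "\<dots> = (\<Sum>k<m. (K (x k) (x (p div d)) *v c k) $ e (p mod d))"
      unfolding d_def e_def matrix_vector_mult_def
      by (simp add: sum_from_nat_into_UNIV[of "\<lambda>i. K _ _ $ _ $ i * c _ $ i"])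
    also have "\<dots> = (\<Sum>k<m. K (x k) (x (p div d)) *v c k) $ e (p mod d)"
      by simp
    also have "\<dots> = 0"
      by (simp add: zero[OF j])
    finally show "vec_index (A *\<^sub>v v) p = vec_index (0\<^sub>v (m * d)) p"
      using p by simp
  qed (use A in simp)
  then have v_zero: "v = 0\<^sub>v (m * d)"
    using invertible_mat_mult_vec_eq_0[OF _ A v] inv by (simp add: A_def)
  show ?thesis
  proof (rule Finite_Cartesian_Product.vec_eq_iff[THEN iffD2], rule allI)
    fix l :: 'd
    have "l \<in> e ` {..<d}"
      using bij_betw_imp_surj_on[OF bij_betw_from_nat_into_finite[of "UNIV :: 'd set"]]
      by (simp add: e_def d_def)
    then obtain i where i: "i < d" "l = e i"
      by auto
    then have "vec_index v (k * d + i) = c k $ l"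
      using less[OF \<open>k < m\<close>] by (simp add: v_def)
    with v_zero less[OF \<open>k < m\<close> i(1)] show "c k $ l = 0 $ l"
      by simp
  qed
qed

section \<open>The coefficient map \<open>kernel_series K\<close> and its injectivity\<close>

locale multitask_kernel =
  fixes K :: "'x \<Rightarrow> 'x \<Rightarrow> real ^ 'd ^ 'd"
  assumes admissible: "admissible_kernel K"
begin

lemma inner_kernel_commute: "(K x y *v v) \<bullet> w = v \<bullet> (K x y *v w)"
  using admissible by (intro inner_matrix_vector_symmetric) (simp add: admissible_kernel_def)

definition kernel_bound :: real where
  "kernel_bound = (SOME \<kappa>. \<kappa> > 0 \<and> (\<forall>x y. l1_onorm (K x y) \<le> \<kappa>))"

lemma kernel_bound: "kernel_bound > 0" "l1_onorm (K x y) \<le> kernel_bound"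
proof -
  have "\<exists>\<kappa>>0. \<forall>x y. l1_onorm (K x y) \<le> \<kappa>"
    using admissible by (simp add: admissible_kernel_def)
  then have "kernel_bound > 0 \<and> (\<forall>x y. l1_onorm (K x y) \<le> kernel_bound)"
    unfolding kernel_bound_def by (rule someI_ex)
  then show "kernel_bound > 0" "l1_onorm (K x y) \<le> kernel_bound"
    by auto
qed

lemma l1norm_kernel_le: "l1norm (K x y *v v) \<le> kernel_bound * l1norm v"
  by (rule order_trans[OF l1norm_matrix_vector_le mult_right_mono[OF kernel_bound(2)]]) simp

lemma kernel_series_abs_summable:
  assumes "c \<in> l1d"
  shows "(\<lambda>x. norm (K x y *v c x)) summable_on UNIV"
proof (rule Infinite_Sum.abs_summable_on_comparison_test')
  show "(\<lambda>x. kernel_bound * l1norm (c x)) summable_on UNIV"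
    using assms by (simp add: l1d_def summable_on_cmult_right)
qed (rule order_trans[OF norm_le_l1norm l1norm_kernel_le])

text \<open>Points off the support contribute \<open>K x y *v 0 = 0\<close>. Summing over all points
  avoids tracking how supports change under linear operations.\<close>

lemma kernel_series_UNIV: "kernel_series K c y = (\<Sum>\<^sub>\<infinity>x. K x y *v c x)"
  unfolding kernel_series_def by (rule infsum_cong_neutral) auto

lemma has_sum_kernel_series:
  assumes "c \<in> l1d"
  shows "((\<lambda>x. K x y *v c x) has_sum kernel_series K c y) UNIV"
  unfolding kernel_series_UNIV
  using Infinite_Sum.abs_summable_summable[OF kernel_series_abs_summable[OF assms]] by simp

text \<open>A termwise comparison with the uniform kernel bound; it makes the point evaluations
  continuous on \<open>BK K\<close>.\<close>

lemma norm_kernel_series_le: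
  assumes "c \<in> l1d"
  shows "norm (kernel_series K c y) \<le> kernel_bound * l1d_norm c"
proof -
  have "norm (kernel_series K c y) \<le> (\<Sum>\<^sub>\<infinity>x. norm (K x y *v c x))"
    unfolding kernel_series_UNIV
    by (rule norm_infsum_bound[OF kernel_series_abs_summable[OF assms]])
  also have "\<dots> \<le> (\<Sum>\<^sub>\<infinity>x. kernel_bound * l1norm (c x))"
    using kernel_series_abs_summable[OF assms] assms
    by (intro infsum_mono order_trans[OF norm_le_l1norm l1norm_kernel_le])
       (simp_all add: l1d_def summable_on_cmult_right)
  finally show ?thesis
    by (simp add: l1d_norm_def infsum_cmult_right')
qed

lemma kernel_series_add:
  assumes "c \<in> l1d" "c' \<in> l1d"
  shows "kernel_series K (\<lambda>x. c x + c' x) = (\<lambda>y. kernel_series K c y + kernel_series K c' y)"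
proof
  fix y
  have "((\<lambda>x. K x y *v c x + K x y *v c' x) has_sum kernel_series K c y + kernel_series K c' y) UNIV"
    by (intro has_sum_add has_sum_kernel_series assms)
  then show "kernel_series K (\<lambda>x. c x + c' x) y = kernel_series K c y + kernel_series K c' y"
    unfolding kernel_series_UNIV[of "\<lambda>x. c x + c' x"] by (simp add: matrix_vector_right_distrib infsumI)
qed

lemma kernel_series_scaleR:
  "kernel_series K (\<lambda>x. a *\<^sub>R c x) = (\<lambda>y. a *\<^sub>R kernel_series K c y)"
  by (simp add: kernel_series_UNIV matrix_vector_mult_scaleR infsum_scaleR_right fun_eq_iff)

lemma kernel_series_diff:
  assumes "c \<in> l1d" "c' \<in> l1d"
  shows "kernel_series K (\<lambda>x. c x - c' x) = (\<lambda>y. kernel_series K c y - kernel_series K c' y)"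
  using kernel_series_add[OF assms(1) normed_fun_spaceD(3)[OF normed_fun_space_l1d assms(2), of "-1"]]
  unfolding kernel_series_scaleR by simp

lemma kernel_series_zero: "kernel_series K (\<lambda>x. 0) = (\<lambda>y. 0)"
  by (simp add: kernel_series_UNIV fun_eq_iff)

lemma kernel_series_single:
  "kernel_series K (\<lambda>t. if t = x then v else 0) = (\<lambda>y. K x y *v v)"
  unfolding kernel_series_UNIV
  by (intro ext infsumI, rule has_sum_finite_neutralI[of "{x}"]) auto

text \<open>On a finite input set the condition on infinite sequences of distinct points is vacuous, and
  injectivity comes from the invertibility of the kernel matrices.\<close>

lemma kernel_series_eq_0_finite:
  assumes fin: "finite (UNIV :: 'x set)" and zero: "\<And>y. kernel_series K c y = 0"
  shows "c t = 0"
proof -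
  \<comment> \<open>Listing the whole input set turns the vanishing of the series at every point
    into the homogeneous system of a single kernel matrix.\<close>
  obtain x where x: "bij_betw x {..<CARD('x)} (UNIV :: 'x set)"
    using ex_bij_betw_nat_finite[OF fin] by (auto simp: lessThan_atLeast0)
  have "CARD('x) \<ge> 1"
    using fin by (simp add: Suc_le_eq card_gt_0_iff)
  then have "invertible_mat (kernel_matrix K CARD('x) x)"
    using admissible x by (simp add: admissible_kernel_def bij_betw_def)
  moreover have "(\<Sum>k<CARD('x). K (x k) (x j) *v c (x k)) = 0" for j
    using sum.reindex_bij_betw[OF x, of "\<lambda>z. K z (x j) *v c z"] zero[of "x j"]
    by (simp add: kernel_series_UNIV fin)
  ultimately have "c (x k) = 0" if "k < CARD('x)" for k
    using kernel_matrix_injective[of K "CARD('x)" x "\<lambda>k. c (x k)"] that by simp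
  moreover obtain k where "k < CARD('x)" "x k = t"
    using bij_betw_imp_surj_on[OF x] by (metis UNIV_I imageE lessThan_iff)
  ultimately show ?thesis
    by blast
qed

text \<open>A summable family has countable support, so one injective sequence can run through all
  points where \<open>c\<close> is nonzero. Vanishing of the series then becomes the premise of the
  admissibility condition on sequences of distinct points.\<close>

lemma kernel_series_eq_0_infinite:
  assumes inf: "infinite (UNIV :: 'x set)" and c: "c \<in> l1d"
    and zero: "\<And>y. kernel_series K c y = 0"
  shows "c t = 0"
proof -
  obtain f :: "nat \<Rightarrow> 'x" where f: "inj f"
    using infinite_countable_subset[OF inf] by auto
  \<comment> \<open>The support of \<open>c\<close> may be finite, so it is padded to a countably infinite set.\<close>
  define T where "T = {t. c t \<noteq> 0} \<union> range f"
  have "(\<lambda>t. norm (l1norm (c t))) summable_on UNIV"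
    using c by (simp add: l1d_def)
  then have "countable {t. c t \<noteq> 0}"
    using Infinite_Sum.abs_summable_countable[of "\<lambda>t. l1norm (c t)" UNIV] by simp
  then have "countable T" "infinite T"
    using f by (auto simp: T_def range_inj_infinite)
  define x where "x = from_nat_into T"
  have x: "bij_betw x UNIV T"
    unfolding x_def by (rule bij_betw_from_nat_into) fact+
  have "inj x"
    using x by (simp add: bij_betw_def)
  have "(\<lambda>t. l1norm (c t)) summable_on range x"
    by (rule l1dD[OF c])
  then have cx: "(\<lambda>j. c (x j)) \<in> l1d"
    using summable_on_reindex[OF \<open>inj x\<close>, of "\<lambda>t. l1norm (c t)"] by (simp add: l1d_def o_def)
  have sum_zero: "((\<lambda>j. K (x j) y *v c (x j)) has_sum 0) UNIV" for y
  proof -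
    have "((\<lambda>t. K t y *v c t) has_sum 0) UNIV"
      using has_sum_kernel_series[OF c, of y] by (simp add: zero)
    then have "((\<lambda>t. K t y *v c t) has_sum 0) T"
      by (rule has_sum_cong_neutral[THEN iffD1, rotated -1]) (auto simp: T_def)
    then show ?thesis
      by (subst has_sum_reindex_bij_betw[OF x, of "\<lambda>t. K t y *v c t"])
  qed
  have "\<forall>c\<in>l1d. (\<forall>y. ((\<lambda>j. K (x j) y *v c j) has_sum 0) UNIV) \<longrightarrow> (\<forall>j. c j = 0)"
    using admissible \<open>inj x\<close> unfolding admissible_kernel_def by simp
  from bspec[OF this cx] have "c (x j) = 0" for j
    using sum_zero by simp
  moreover have "t \<in> range x" if "c t \<noteq> 0"
    using that bij_betw_imp_surj_on[OF x] by (auto simp: T_def)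
  ultimately show ?thesis
    by auto
qed

lemma kernel_series_inject:
  assumes "c \<in> l1d" "c' \<in> l1d" "kernel_series K c = kernel_series K c'"
  shows "c = c'"
proof
  fix t
  have "(\<lambda>x. c x - c' x) \<in> l1d"
    by (rule normed_fun_space_diff[OF normed_fun_space_l1d assms(1,2)])
  moreover have "kernel_series K (\<lambda>x. c x - c' x) y = 0" for y
    using kernel_series_diff[OF assms(1,2)] assms(3) by simp
  ultimately have "c t - c' t = 0"
    using kernel_series_eq_0_finite[of "\<lambda>x. c x - c' x" t]
      kernel_series_eq_0_infinite[of "\<lambda>x. c x - c' x" t] by blast
  then show "c t = c' t"
    by simp
qed


section \<open>The space \<open>BK\<close>\<close>

lemma BK_norm_kernel_series:
  assumes "c \<in> l1d"
  shows "BK_norm K (kernel_series K c) = l1d_norm c"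
  unfolding BK_norm_def
proof (rule the_equality)
  show "\<exists>c'\<in>l1d. kernel_series K c = kernel_series K c' \<and> l1d_norm c = l1d_norm c'"
    using assms by (intro bexI[of _ c]) auto
  fix r assume "\<exists>c'\<in>l1d. kernel_series K c = kernel_series K c' \<and> r = l1d_norm c'"
  then obtain c' where c': "c' \<in> l1d" "kernel_series K c = kernel_series K c'" "r = l1d_norm c'"
    by (elim bexE conjE)
  then show "r = l1d_norm c"
    using kernel_series_inject[OF assms c'(1,2)] by simp
qed

lemma kernel_series_in_BK: "c \<in> l1d \<Longrightarrow> kernel_series K c \<in> BK K"
  unfolding BK_def by blast

lemma BK_E:
  assumes "f \<in> BK K"
  obtains c where "c \<in> l1d" "f = kernel_series K c"
  using assms unfolding BK_def by (elim CollectE exE conjE)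

lemma normed_fun_space_BK: "normed_fun_space (BK K) (BK_norm K)"
  unfolding normed_fun_space_def
proof (intro conjI ballI allI)
  note l1d = normed_fun_spaceD[OF normed_fun_space_l1d]
  show "(\<lambda>x. 0) \<in> BK K"
    using kernel_series_in_BK[OF l1d(1)] by (simp add: kernel_series_zero)
  fix f a assume "f \<in> BK K"
  then obtain c where c: "c \<in> l1d" "f = kernel_series K c"
    by (rule BK_E)
  show "(\<lambda>x. a *\<^sub>R f x) \<in> BK K"
    using kernel_series_in_BK[OF l1d(3)[OF c(1), of a]] by (simp add: c kernel_series_scaleR)
  show "0 \<le> BK_norm K f"
    using l1d(4)[OF c(1)] by (simp add: c BK_norm_kernel_series)
  show "BK_norm K (\<lambda>x. a *\<^sub>R f x) = \<bar>a\<bar> * BK_norm K f"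
    using BK_norm_kernel_series[OF l1d(3)[OF c(1), of a]] l1d(6)[OF c(1), of a]
    by (simp add: c kernel_series_scaleR BK_norm_kernel_series)
  show "BK_norm K f = 0 \<longleftrightarrow> (\<forall>x. f x = 0)"
  proof
    assume "BK_norm K f = 0"
    then have "\<forall>x. c x = 0"
      using l1d(5)[OF c(1)] by (simp add: c BK_norm_kernel_series)
    then show "\<forall>x. f x = 0"
      by (simp add: c kernel_series_UNIV)
  next
    assume "\<forall>x. f x = 0"
    then have "kernel_series K c = kernel_series K (\<lambda>x. 0)"
      by (simp add: c(2)[symmetric] kernel_series_zero fun_eq_iff)
    from kernel_series_inject[OF c(1) l1d(1) this] show "BK_norm K f = 0"
      unfolding c(2) BK_norm_kernel_series[OF c(1)] l1d(5)[OF c(1)] by simp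
  qed
  fix g assume "g \<in> BK K"
  then obtain c' where c': "c' \<in> l1d" "g = kernel_series K c'"
    by (rule BK_E)
  show "(\<lambda>x. f x + g x) \<in> BK K"
    using kernel_series_in_BK[OF l1d(2)[OF c(1) c'(1)]]
    by (simp add: c c' kernel_series_add)
  show "BK_norm K (\<lambda>x. f x + g x) \<le> BK_norm K f + BK_norm K g"
    using BK_norm_kernel_series[OF l1d(2)[OF c(1) c'(1)]] l1d(7)[OF c(1) c'(1)]
    by (simp add: c c' kernel_series_add BK_norm_kernel_series)
qed

text \<open>The coefficient map is a linear isometry; through this identity Cauchy sequences and
  limits are moved between \<open>BK K\<close> and \<open>l1d\<close>.\<close>

lemma BK_norm_diff:
  assumes "c \<in> l1d" "c' \<in> l1d"
  shows "BK_norm K (\<lambda>x. kernel_series K c x - kernel_series K c' x) = l1d_norm (\<lambda>x. c x - c' x)"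
  using BK_norm_kernel_series[OF normed_fun_space_diff[OF normed_fun_space_l1d assms]]
  by (simp add: kernel_series_diff assms)

lemma mcomplete_BK: "Metric_space.mcomplete (BK K) (norm_dist (BK K) (BK_norm K))"
proof (rule mcomplete_norm_distI[OF normed_fun_space_BK])
  fix \<sigma> :: "nat \<Rightarrow> 'x \<Rightarrow> real ^ 'd"
  assume \<sigma>: "\<And>n. \<sigma> n \<in> BK K"
    and Cauchy: "\<And>e. e > 0 \<Longrightarrow> \<exists>M. \<forall>m\<ge>M. \<forall>n\<ge>M. BK_norm K (\<lambda>x. \<sigma> m x - \<sigma> n x) < e"
  have "\<forall>n. \<exists>c. c \<in> l1d \<and> \<sigma> n = kernel_series K c"
    using BK_E[OF \<sigma>] by metis
  then obtain c where c: "\<And>n. c n \<in> l1d" "\<And>n. \<sigma> n = kernel_series K (c n)"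
    by metis
  have "\<exists>M. \<forall>m\<ge>M. \<forall>n\<ge>M. l1d_norm (\<lambda>t. c m t - c n t) < e" if "e > 0" for e
    using Cauchy[OF that] by (simp add: c BK_norm_diff)
  then have "\<exists>a\<in>l1d. (\<lambda>n. l1d_norm (\<lambda>t. c n t - a t)) \<longlonglongrightarrow> 0"
    by (rule l1d_complete[OF c(1)])
  then obtain a where "a \<in> l1d" "(\<lambda>n. l1d_norm (\<lambda>t. c n t - a t)) \<longlonglongrightarrow> 0"
    by (rule bexE)
  then show "\<exists>g\<in>BK K. (\<lambda>n. BK_norm K (\<lambda>x. \<sigma> n x - g x)) \<longlonglongrightarrow> 0"
    by (intro bexI[of _ "kernel_series K a"] kernel_series_in_BK) (simp_all add: c BK_norm_diff)
qed

lemma vector_rkbs_BK: "vector_rkbs (BK K) (BK_norm K)"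
  unfolding vector_rkbs_def
proof (intro conjI allI normed_fun_space_BK mcomplete_BK)
  fix x
  show "continuous_map (norm_topology (BK K) (BK_norm K)) euclidean (\<lambda>f. f x)"
  proof (rule continuous_map_evaluation[OF normed_fun_space_BK])
    fix f assume "f \<in> BK K"
    then obtain c where "c \<in> l1d" "f = kernel_series K c"
      by (rule BK_E)
    then show "norm (f x) \<le> kernel_bound * BK_norm K f"
      by (simp add: BK_norm_kernel_series norm_kernel_series_le)
  qed
qed

section \<open>The space \<open>BK_sharp\<close>\<close>

lemma infnorm_kernel_le: "infnorm (K x y *v v) \<le> kernel_bound * l1norm v"
  by (rule order_trans[OF infnorm_le_l1norm l1norm_kernel_le])

lemma right_sum_Suc:
  "right_sum K (Suc n) s b = (\<lambda>t. right_sum K n s b t + K t (s n) *v b n)"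
  by (simp add: right_sum_def)

lemma bounded_right_sum: "bounded (range (right_sum K n s b))"
proof (induction n)
  case 0
  then show ?case
    by (intro bounded_range_infnormI[of _ 0]) (simp add: right_sum_def infnorm_0)
next
  case (Suc n)
  then show ?case
    unfolding right_sum_Suc
    by (intro bounded_range_add bounded_range_infnormI[OF infnorm_kernel_le])
qed

lemma B0_sharpI: "n \<ge> 1 \<Longrightarrow> right_sum K n s b \<in> B0_sharp K"
  unfolding B0_sharp_def by blast

lemma B0_sharpE:
  assumes "g \<in> B0_sharp K"
  obtains n s b where "n \<ge> 1" "g = right_sum K n s b"
  using assms unfolding B0_sharp_def by (elim CollectE exE conjE)

lemma bounded_B0_sharp: "g \<in> B0_sharp K \<Longrightarrow> bounded (range g)"
  using bounded_right_sum by (elim B0_sharpE) simp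

lemma kernel_in_B0_sharp: "(\<lambda>t. K t x *v v) \<in> B0_sharp K"
  using B0_sharpI[of 1 "\<lambda>_. x" "\<lambda>_. v"] by (simp add: right_sum_def)

lemma B0_sharp_scaleR:
  assumes "g \<in> B0_sharp K"
  shows "(\<lambda>t. a *\<^sub>R g t) \<in> B0_sharp K"
proof -
  obtain n s b where "n \<ge> 1" "g = right_sum K n s b"
    using assms by (rule B0_sharpE)
  then show ?thesis
    using B0_sharpI[of n s "\<lambda>k. a *\<^sub>R b k"]
    by (simp add: right_sum_def matrix_vector_mult_scaleR scaleR_sum_right)
qed

lemma B0_sharp_add_kernel:
  assumes "g \<in> B0_sharp K"
  shows "(\<lambda>t. g t + K t x *v v) \<in> B0_sharp K"
proof -
  obtain n s b where g: "n \<ge> 1" "g = right_sum K n s b"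
    using assms by (rule B0_sharpE)
  \<comment> \<open>\<open>right_sum K n s b\<close> reads only indices below \<open>n\<close>, so
    overwriting \<open>s\<close> and \<open>b\<close> at \<open>n\<close> leaves \<open>g\<close>
    intact.\<close>
  have "right_sum K (Suc n) (s(n := x)) (b(n := v)) = (\<lambda>t. g t + K t x *v v)"
    unfolding right_sum_def g(2) by (auto intro!: ext sum.cong)
  then show ?thesis
    using B0_sharpI[of "Suc n" "s(n := x)" "b(n := v)"] by simp
qed

text \<open>The terms of the second summand are appended one at a time, which avoids concatenating
  two indexed families. Starting from \<open>f\<close> keeps the number of terms positive.\<close>

lemma B0_sharp_add:
  assumes "f \<in> B0_sharp K" "g \<in> B0_sharp K"
  shows "(\<lambda>t. f t + g t) \<in> B0_sharp K"
proof -
  obtain n s b where g: "n \<ge> 1" "g = right_sum K n s b"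
    using assms(2) by (rule B0_sharpE)
  have "(\<lambda>t. f t + right_sum K n s b t) \<in> B0_sharp K" for n
  proof (induction n)
    case 0
    then show ?case
      using assms(1) by (simp add: right_sum_def)
  next
    case (Suc n)
    then show ?case
      using B0_sharp_add_kernel[OF Suc, of "s n" "b n"] by (simp add: right_sum_Suc add.assoc)
  qed
  then show ?thesis
    by (simp add: g(2))
qed

text \<open>A uniform Cauchy estimate survives a pointwise limit: fix one index and let the other
  tend to infinity. With the converse \<open>BK_sharpI\<close>, membership in
  \<open>BK_sharp K\<close> becomes uniform approximability within every \<open>e\<close>.\<close>

lemma BK_sharp_approx:
  assumes "g \<in> BK_sharp K" "e > 0"
  shows "\<exists>h\<in>B0_sharp K. \<forall>t. infnorm (h t - g t) \<le> e"
proof -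
  obtain h where h: "\<And>n. h n \<in> B0_sharp K"
      "\<forall>e>0. \<exists>M. \<forall>m\<ge>M. \<forall>n\<ge>M. sup_norm (\<lambda>t. h m t - h n t) < e"
      "\<And>t. (\<lambda>n. h n t) \<longlonglongrightarrow> g t"
    using assms(1) unfolding BK_sharp_def by auto
  obtain M where M: "\<forall>m\<ge>M. \<forall>n\<ge>M. sup_norm (\<lambda>t. h m t - h n t) < e"
    using h(2) assms(2) by auto
  have "infnorm (h M t - g t) \<le> e" for t
  proof (rule tendsto_upperbound)
    show "(\<lambda>n. infnorm (h M t - h n t)) \<longlonglongrightarrow> infnorm (h M t - g t)"
      by (intro tendsto_intros h(3))
    have "infnorm (h M t - h n t) \<le> e" if "n \<ge> M" for n
      using infnorm_le_sup_norm[OF bounded_range_diff[OF bounded_B0_sharp[OF h(1)[of M]]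
            bounded_B0_sharp[OF h(1)[of n]]], of t] M that by fastforce
    then show "\<forall>\<^sub>F n in sequentially. infnorm (h M t - h n t) \<le> e"
      by (auto simp: eventually_sequentially)
  qed simp
  then show ?thesis
    using h(1)[of M] by (intro bexI[of _ "h M"]) auto
qed

lemma B0_sharp_approx_sequence:
  assumes "\<And>e. e > 0 \<Longrightarrow> \<exists>h\<in>B0_sharp K. \<forall>t. infnorm (h t - g t) \<le> e"
  obtains h where "\<And>n. h n \<in> B0_sharp K" "\<And>n t. infnorm (h n t - g t) \<le> 1 / Suc n"
proof -
  have "\<forall>n. \<exists>h. h \<in> B0_sharp K \<and> (\<forall>t. infnorm (h t - g t) \<le> 1 / Suc n)"
  proof
    fix n
    show "\<exists>h. h \<in> B0_sharp K \<and> (\<forall>t. infnorm (h t - g t) \<le> 1 / Suc n)"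
      using assms[of "1 / Suc n"] by auto
  qed
  from choice[OF this] obtain h where
    "\<forall>n. h n \<in> B0_sharp K \<and> (\<forall>t. infnorm (h n t - g t) \<le> 1 / Suc n)"
    by (rule exE)
  then show ?thesis
    by (intro that) auto
qed

text \<open>Approximants of accuracy \<open>1 / Suc n\<close> form the required sequence: comparing
  two of them through \<open>g\<close> shows it uniformly Cauchy, and the accuracy itself forces
  pointwise convergence to \<open>g\<close>.\<close>

lemma BK_sharpI:
  assumes "\<And>e. e > 0 \<Longrightarrow> \<exists>h\<in>B0_sharp K. \<forall>t. infnorm (h t - g t) \<le> e"
  shows "g \<in> BK_sharp K"
proof -
  obtain h where h: "\<And>n. h n \<in> B0_sharp K" "\<And>n t. infnorm (h n t - g t) \<le> 1 / Suc n"
    using B0_sharp_approx_sequence[OF assms] by blast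
  have "\<exists>M. \<forall>m\<ge>M. \<forall>n\<ge>M. sup_norm (\<lambda>t. h m t - h n t) < e" if "e > 0" for e
  proof -
    have "e / 2 > 0"
      using that by simp
    then obtain M where M: "1 / Suc M < e / 2"
      by (rule nat_approx_posE)
    have "sup_norm (\<lambda>t. h m t - h n t) < e" if "m \<ge> M" "n \<ge> M" for m n
    proof -
      have "infnorm (h m t - h n t) \<le> 1 / Suc M + 1 / Suc M" for t
      proof -
        have "infnorm (h m t - h n t) \<le> infnorm (h m t - g t) + infnorm (h n t - g t)"
          using infnorm_triangle[of "h m t - g t" "g t - h n t"] infnorm_sub[of "g t" "h n t"] by simp
        also have "\<dots> \<le> 1 / Suc m + 1 / Suc n"
          by (intro add_mono h(2))
        also have "\<dots> \<le> 1 / Suc M + 1 / Suc M"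
          using that by (intro add_mono divide_left_mono) auto
        finally show ?thesis .
      qed
      then show ?thesis
        using M by (intro order_le_less_trans[OF sup_norm_least]) auto
    qed
    then show ?thesis
      by blast
  qed
  moreover have "(\<lambda>n. h n t) \<longlonglongrightarrow> g t" for t
  proof (rule tendsto_infnormI, rule tendsto_0_le_inverse_Suc)
    show "0 \<le> infnorm (h n t - g t)" for n
      by (intro infnorm_pos_le)
    show "infnorm (h n t - g t) \<le> 1 / Suc n" for n
      by (intro h(2))
  qed
  ultimately show ?thesis
    unfolding BK_sharp_def using h(1) by (intro CollectI exI[of _ h] conjI allI impI)
qed

lemma B0_sharp_subset_BK_sharp: "g \<in> B0_sharp K \<Longrightarrow> g \<in> BK_sharp K"
  by (rule BK_sharpI, rule bexI[of _ g]) (simp_all add: infnorm_0)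

text \<open>\<open>g\<close> lies within uniform distance 1 of a bounded finite sum. This keeps
  \<open>sup_norm\<close> meaningful on all of \<open>BK_sharp K\<close>.\<close>

lemma bounded_BK_sharp:
  assumes "g \<in> BK_sharp K"
  shows "bounded (range g)"
proof -
  obtain h where h: "h \<in> B0_sharp K" "\<forall>t. infnorm (h t - g t) \<le> 1"
    using BK_sharp_approx[OF assms, of 1] by auto
  then have "bounded (range (\<lambda>t. h t - (h t - g t)))"
    by (intro bounded_range_diff bounded_B0_sharp bounded_range_infnormI[of _ 1]) auto
  then show ?thesis
    by simp
qed

lemma normed_fun_space_BK_sharp: "normed_fun_space (BK_sharp K) sup_norm"
proof (rule normed_fun_space_sup_norm)
  show "bounded (range g)" if "g \<in> BK_sharp K" for g
    by (rule bounded_BK_sharp[OF that])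
  show "(\<lambda>x. 0) \<in> BK_sharp K"
    using B0_sharp_subset_BK_sharp[OF kernel_in_B0_sharp[of _ 0]] by simp
  show "(\<lambda>x. f x + g x) \<in> BK_sharp K" if f: "f \<in> BK_sharp K" and g: "g \<in> BK_sharp K" for f g
  proof (rule BK_sharpI)
    fix e :: real assume "e > 0"
    then have "e / 2 > 0"
      by simp
    then obtain h h' where h: "h \<in> B0_sharp K" "\<forall>t. infnorm (h t - f t) \<le> e / 2"
        "h' \<in> B0_sharp K" "\<forall>t. infnorm (h' t - g t) \<le> e / 2"
      using BK_sharp_approx[OF f \<open>e / 2 > 0\<close>] BK_sharp_approx[OF g \<open>e / 2 > 0\<close>] by (elim bexE)
    have "infnorm (h t + h' t - (f t + g t)) \<le> e" for t
      using infnorm_triangle[of "h t - f t" "h' t - g t"] h(2)[rule_format, of t] h(4)[rule_format, of t]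
      by (simp add: add_diff_add)
    then show "\<exists>k\<in>B0_sharp K. \<forall>t. infnorm (k t - (f t + g t)) \<le> e"
      by (intro bexI[of _ "\<lambda>t. h t + h' t"] B0_sharp_add h(1,3) allI)
  qed
  show "(\<lambda>x. a *\<^sub>R g x) \<in> BK_sharp K" if g: "g \<in> BK_sharp K" for a g
  proof (rule BK_sharpI)
    fix e :: real assume "e > 0"
    \<comment> \<open>The added 1 keeps the tolerance positive when \<open>a = 0\<close>.\<close>
    then have "e / (\<bar>a\<bar> + 1) > 0"
      by (intro divide_pos_pos) auto
    from BK_sharp_approx[OF g this] obtain h
      where h: "h \<in> B0_sharp K" "\<forall>t. infnorm (h t - g t) \<le> e / (\<bar>a\<bar> + 1)"
      by (rule bexE)
    have "infnorm (a *\<^sub>R h t - a *\<^sub>R g t) \<le> e" for t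
    proof -
      have "infnorm (a *\<^sub>R h t - a *\<^sub>R g t) = \<bar>a\<bar> * infnorm (h t - g t)"
        by (simp add: infnorm_mul flip: scaleR_diff_right)
      also have "\<dots> \<le> (\<bar>a\<bar> + 1) * (e / (\<bar>a\<bar> + 1))"
        using h(2) by (intro mult_mono) (auto simp: infnorm_pos_le)
      finally show ?thesis
        by simp
    qed
    then show "\<exists>k\<in>B0_sharp K. \<forall>t. infnorm (k t - a *\<^sub>R g t) \<le> e"
      by (intro bexI[of _ "\<lambda>t. a *\<^sub>R h t"] B0_sharp_scaleR h(1) allI)
  qed
qed

text \<open>A uniform closure is closed: convergence to the pointwise limit is uniform, and a late
  member of the sequence is itself approximated from \<open>B0_sharp K\<close>, with
  \<open>e / 2\<close> spent on each.\<close>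

lemma mcomplete_BK_sharp: "Metric_space.mcomplete (BK_sharp K) (norm_dist (BK_sharp K) sup_norm)"
proof (rule mcomplete_norm_distI[OF normed_fun_space_BK_sharp])
  fix \<sigma> :: "nat \<Rightarrow> 'x \<Rightarrow> real ^ 'd"
  assume \<sigma>: "\<And>n. \<sigma> n \<in> BK_sharp K"
    and Cauchy: "\<And>e. e > 0 \<Longrightarrow> \<exists>M. \<forall>m\<ge>M. \<forall>n\<ge>M. sup_norm (\<lambda>x. \<sigma> m x - \<sigma> n x) < e"
  have uniform: "\<exists>M. \<forall>m\<ge>M. \<forall>n\<ge>M. \<forall>t. infnorm (\<sigma> m t - \<sigma> n t) < e" if e: "e > 0" for e
  proof -
    obtain M where M: "\<forall>m\<ge>M. \<forall>n\<ge>M. sup_norm (\<lambda>x. \<sigma> m x - \<sigma> n x) < e"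
      using Cauchy[OF e] by (rule exE)
    have "infnorm (\<sigma> m t - \<sigma> n t) < e" if "m \<ge> M" "n \<ge> M" for m n t
      using infnorm_le_sup_norm[OF bounded_range_diff[OF bounded_BK_sharp[OF \<sigma>[of m]]
            bounded_BK_sharp[OF \<sigma>[of n]]], of t] M[rule_format, OF that] by simp
    then show ?thesis
      by blast
  qed
  have "Cauchy (\<lambda>n. \<sigma> n t)" for t
  proof (rule metric_CauchyI)
    fix e :: real assume "e > 0"
    \<comment> \<open>Dividing by the norm equivalence factor turns the estimate in
      \<open>infnorm\<close> into one for \<open>dist\<close>.\<close>
    then have "e / sqrt DIM(real ^ 'd) > 0"
      by simp
    from uniform[OF this] obtain M where
      M: "\<forall>m\<ge>M. \<forall>n\<ge>M. \<forall>t. infnorm (\<sigma> m t - \<sigma> n t) < e / sqrt DIM(real ^ 'd)"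
      by (rule exE)
    have "dist (\<sigma> m t) (\<sigma> n t) < e" if "m \<ge> M" "n \<ge> M" for m n
    proof -
      have "dist (\<sigma> m t) (\<sigma> n t) \<le> sqrt DIM(real ^ 'd) * infnorm (\<sigma> m t - \<sigma> n t)"
        by (simp add: dist_norm norm_le_infnorm del: DIM_cart)
      also have "\<dots> < sqrt DIM(real ^ 'd) * (e / sqrt DIM(real ^ 'd))"
        using M[rule_format, OF that, of t] by (intro mult_strict_left_mono) auto
      finally show ?thesis
        by simp
    qed
    then show "\<exists>M. \<forall>m\<ge>M. \<forall>n\<ge>M. dist (\<sigma> m t) (\<sigma> n t) < e"
      by blast
  qed
  then have "\<forall>t. \<exists>l. (\<lambda>n. \<sigma> n t) \<longlonglongrightarrow> l"
    unfolding Cauchy_convergent_iff convergent_def by simp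
  from choice[OF this] obtain g where g: "\<forall>t. (\<lambda>n. \<sigma> n t) \<longlonglongrightarrow> g t"
    by (rule exE)
  have close: "\<exists>M. \<forall>n\<ge>M. \<forall>t. infnorm (\<sigma> n t - g t) \<le> e" if e: "e > 0" for e
  proof -
    obtain M where M: "\<forall>m\<ge>M. \<forall>n\<ge>M. \<forall>t. infnorm (\<sigma> m t - \<sigma> n t) < e"
      using uniform[OF e] by (rule exE)
    have "infnorm (\<sigma> n t - g t) \<le> e" if "n \<ge> M" for n t
    proof (rule tendsto_upperbound)
      show "(\<lambda>m. infnorm (\<sigma> n t - \<sigma> m t)) \<longlonglongrightarrow> infnorm (\<sigma> n t - g t)"
        by (intro tendsto_intros g[rule_format])
      show "\<forall>\<^sub>F m in sequentially. infnorm (\<sigma> n t - \<sigma> m t) \<le> e"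
        using M that by (auto simp: eventually_sequentially intro!: exI[of _ M] less_imp_le)
    qed simp
    then show ?thesis
      by blast
  qed
  have "g \<in> BK_sharp K"
  proof (rule BK_sharpI)
    fix e :: real assume "e > 0"
    then have e: "e / 2 > 0"
      by simp
    from close[OF this] obtain n where n: "\<forall>t. infnorm (\<sigma> n t - g t) \<le> e / 2"
      by auto
    obtain h where h: "h \<in> B0_sharp K" "\<forall>t. infnorm (h t - \<sigma> n t) \<le> e / 2"
      using BK_sharp_approx[OF \<sigma>[of n] e] by (rule bexE)
    have "infnorm (h t - g t) \<le> e" for t
      using infnorm_triangle[of "h t - \<sigma> n t" "\<sigma> n t - g t"]
        h(2)[rule_format, of t] n[rule_format, of t] by simp
    then show "\<exists>h\<in>B0_sharp K. \<forall>t. infnorm (h t - g t) \<le> e"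
      by (intro bexI[of _ h] h(1) allI)
  qed
  moreover have "(\<lambda>n. sup_norm (\<lambda>x. \<sigma> n x - g x)) \<longlonglongrightarrow> 0"
  proof (rule LIMSEQ_I)
    fix e :: real assume "e > 0"
    then have "e / 2 > 0"
      by simp
    from close[OF this] obtain M where M: "\<forall>n\<ge>M. \<forall>t. infnorm (\<sigma> n t - g t) \<le> e / 2"
      by (rule exE)
    have "norm (sup_norm (\<lambda>x. \<sigma> n x - g x) - 0) < e" if "n \<ge> M" for n
    proof -
      have le: "infnorm (\<sigma> n t - g t) \<le> e / 2" for t
        using M that by simp
      have "sup_norm (\<lambda>x. \<sigma> n x - g x) \<ge> 0"
        by (rule sup_norm_nonneg[OF bounded_range_infnormI[OF le]])
      then show ?thesis
        using sup_norm_least[of "\<lambda>t. \<sigma> n t - g t", OF le] \<open>e > 0\<close> by simp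
    qed
    then show "\<exists>M. \<forall>n\<ge>M. norm (sup_norm (\<lambda>x. \<sigma> n x - g x) - 0) < e"
      by blast
  qed
  ultimately show "\<exists>g\<in>BK_sharp K. (\<lambda>n. sup_norm (\<lambda>x. \<sigma> n x - g x)) \<longlonglongrightarrow> 0"
    by (intro bexI[of _ g])
qed

lemma vector_rkbs_BK_sharp: "vector_rkbs (BK_sharp K) sup_norm"
  unfolding vector_rkbs_def
proof (intro conjI allI normed_fun_space_BK_sharp mcomplete_BK_sharp)
  fix x
  show "continuous_map (norm_topology (BK_sharp K) sup_norm) euclidean (\<lambda>f. f x)"
  proof (rule continuous_map_evaluation[OF normed_fun_space_BK_sharp])
    fix g assume "g \<in> BK_sharp K"
    then have "infnorm (g x) \<le> sup_norm g"
      by (intro infnorm_le_sup_norm bounded_BK_sharp)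
    then show "norm (g x) \<le> sqrt DIM(real ^ 'd) * sup_norm g"
      by (intro order_trans[OF norm_le_infnorm] mult_left_mono) auto
  qed
qed

section \<open>The bilinear form\<close>

text \<open>The points \<open>x j\<close> may repeat, so coefficients at equal points accumulate and
  \<open>c\<close> cannot be read back from \<open>a\<close>. Hence the induction carries the value
  of the pairing along with the series, adding one point mass per term.\<close>

lemma left_sum_coefficients:
  "\<exists>a\<in>l1d. left_sum K m x c = kernel_series K a \<and>
    (\<forall>g. bounded (range g) \<longrightarrow> l1d_pairing a g = (\<Sum>j<m. c j \<bullet> g (x j)))"
proof (induction m)
  case 0
  show ?case
    by (rule bexI[of _ "\<lambda>t. 0"])
      (simp_all add: left_sum_def kernel_series_zero l1d_pairing_def normed_fun_spaceD(1)[OF normed_fun_space_l1d])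
next
  case (Suc m)
  then obtain a where a: "a \<in> l1d" "left_sum K m x c = kernel_series K a"
    "\<And>g. bounded (range g) \<Longrightarrow> l1d_pairing a g = (\<Sum>j<m. c j \<bullet> g (x j))"
    by auto
  define \<delta> where "\<delta> = (\<lambda>t. if t = x m then c m else 0)"
  have \<delta>: "\<delta> \<in> l1d"
    by (rule l1d_finite_support(1)[of "{x m}"]) (simp_all add: \<delta>_def)
  show ?case
  proof (intro bexI conjI allI impI)
    show "(\<lambda>t. a t + \<delta> t) \<in> l1d"
      by (rule normed_fun_spaceD(2)[OF normed_fun_space_l1d a(1) \<delta>])
    have "left_sum K (Suc m) x c = (\<lambda>t. left_sum K m x c t + K (x m) t *v c m)"
      by (simp add: left_sum_def)
    also have "\<dots> = kernel_series K (\<lambda>t. a t + \<delta> t)"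
      unfolding kernel_series_add[OF a(1) \<delta>] a(2) by (simp add: \<delta>_def kernel_series_single)
    finally show "left_sum K (Suc m) x c = kernel_series K (\<lambda>t. a t + \<delta> t)" .
    fix g :: "'x \<Rightarrow> real ^ 'd" assume g: "bounded (range g)"
    have "l1d_pairing \<delta> g = c m \<bullet> g (x m)"
      unfolding \<delta>_def by (rule l1d_pairing_single)
    then show "l1d_pairing (\<lambda>t. a t + \<delta> t) g = (\<Sum>j<Suc m. c j \<bullet> g (x j))"
      by (simp add: l1d_pairing_add_left[OF a(1) \<delta> g] a(3)[OF g])
  qed
qed

lemma B0E:
  assumes "f \<in> B0 K"
  obtains m x c where "m \<ge> 1" "f = left_sum K m x c"
  using assms unfolding B0_def by (elim CollectE exE conjE)

lemma B0_coefficients: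
  assumes "f \<in> B0 K"
  obtains a where "a \<in> l1d" "f = kernel_series K a"
proof -
  obtain m x c where "f = left_sum K m x c"
    using assms by (rule B0E)
  moreover obtain a where "a \<in> l1d" "left_sum K m x c = kernel_series K a"
    using left_sum_coefficients[of m x c] by auto
  ultimately show ?thesis
    using that by simp
qed

lemma kernel_series_finite_in_B0:
  assumes "finite S" "S \<noteq> {}"
  shows "kernel_series K (\<lambda>t. if t \<in> S then c t else 0) \<in> B0 K"
proof -
  obtain x where x: "bij_betw x {..<card S} S"
    using ex_bij_betw_nat_finite[OF assms(1)] by (auto simp: lessThan_atLeast0)
  have "kernel_series K (\<lambda>t. if t \<in> S then c t else 0) y = left_sum K (card S) x (\<lambda>j. c (x j)) y" for y
  proof -
    have "((\<lambda>t. K t y *v (if t \<in> S then c t else 0)) has_sum (\<Sum>t\<in>S. K t y *v c t)) UNIV"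
      by (rule has_sum_finite_neutralI[OF assms(1)]) auto
    moreover have "(\<Sum>t\<in>S. K t y *v c t) = left_sum K (card S) x (\<lambda>j. c (x j)) y"
      unfolding left_sum_def by (rule sum.reindex_bij_betw[OF x, symmetric])
    ultimately show ?thesis
      by (simp add: kernel_series_UNIV infsumI)
  qed
  moreover have "card S \<ge> 1"
    using assms by (simp add: Suc_le_eq card_gt_0_iff)
  ultimately show ?thesis
    unfolding B0_def by blast
qed

text \<open>The right side depends on the two functions only, not on how they are written as finite
  sums. Uniqueness enters by identifying \<open>a\<close> with the family that
  \<open>left_sum_coefficients\<close> produces.\<close>

lemma form0_value:
  assumes "a \<in> l1d" "kernel_series K a = left_sum K m x c"
  shows "(\<Sum>k<n. \<Sum>j<m. c j \<bullet> (K (x j) (s k) *v b k)) = l1d_pairing a (right_sum K n s b)"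
proof -
  obtain a' where a': "a' \<in> l1d" "left_sum K m x c = kernel_series K a'"
    "l1d_pairing a' (right_sum K n s b) = (\<Sum>j<m. c j \<bullet> right_sum K n s b (x j))"
    using left_sum_coefficients[of m x c] bounded_right_sum[of n s b] by auto
  have "a' = a"
    using kernel_series_inject[OF a'(1) assms(1)] a'(2) assms(2) by simp
  then have "l1d_pairing a (right_sum K n s b) = (\<Sum>j<m. \<Sum>k<n. c j \<bullet> (K (x j) (s k) *v b k))"
    using a'(3) by (simp add: right_sum_def inner_sum_right)
  then show ?thesis
    by (subst sum.swap) simp
qed

lemma form0_kernel_series:
  assumes a: "a \<in> l1d" "kernel_series K a \<in> B0 K" and g: "g \<in> B0_sharp K"
  shows "form0 K (kernel_series K a) g = l1d_pairing a g"
  unfolding form0_def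
proof (rule the_equality)
  obtain m x c where f: "m \<ge> 1" "kernel_series K a = left_sum K m x c"
    using a(2) by (rule B0E)
  obtain n s b where g: "n \<ge> 1" "g = right_sum K n s b"
    using g by (rule B0_sharpE)
  have "l1d_pairing a g = (\<Sum>k<n. \<Sum>j<m. c j \<bullet> (K (x j) (s k) *v b k))"
    unfolding g(2) by (rule form0_value[OF a(1) f(2), symmetric])
  with f g show "\<exists>m\<ge>1. \<exists>x c. \<exists>n\<ge>1. \<exists>s b. kernel_series K a = left_sum K m x c \<and>
      g = right_sum K n s b \<and> l1d_pairing a g = (\<Sum>k<n. \<Sum>j<m. c j \<bullet> (K (x j) (s k) *v b k))"
    by blast
next
  fix r
  assume "\<exists>m\<ge>1. \<exists>x c. \<exists>n\<ge>1. \<exists>s b. kernel_series K a = left_sum K m x c \<and>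
    g = right_sum K n s b \<and> r = (\<Sum>k<n. \<Sum>j<m. c j \<bullet> (K (x j) (s k) *v b k))"
  then obtain m x c n s b where "kernel_series K a = left_sum K m x c" "g = right_sum K n s b"
    "r = (\<Sum>k<n. \<Sum>j<m. c j \<bullet> (K (x j) (s k) *v b k))"
    by (elim exE conjE)
  then show "r = l1d_pairing a g"
    using form0_value[OF a(1)] by simp
qed

text \<open>Truncating the coefficients to finite nonempty sets lands in \<open>B0 K\<close>, and
  summability makes the tails small.\<close>

lemma B0_dense_sequence:
  assumes c: "c \<in> l1d"
  shows "\<exists>F. (\<forall>n. F n \<in> B0 K) \<and> (\<lambda>n. BK_norm K (\<lambda>t. F n t - kernel_series K c t)) \<longlonglongrightarrow> 0"
proof -
  have "\<forall>n. \<exists>S. finite S \<and> S \<noteq> {} \<and>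
      l1d_norm (\<lambda>t. (if t \<in> S then c t else 0) - c t) < 1 / Suc n"
    using l1d_finite_approx[OF c] by simp
  from choice[OF this] obtain S where S: "\<And>n. finite (S n)" "\<And>n. S n \<noteq> {}"
    "\<And>n. l1d_norm (\<lambda>t. (if t \<in> S n then c t else 0) - c t) < 1 / Suc n"
    by blast
  define a where "a = (\<lambda>n t. if t \<in> S n then c t else 0)"
  have a: "a n \<in> l1d" for n
    by (rule l1d_finite_support(1)[OF S(1)[of n]]) (simp add: a_def)
  have "(\<lambda>n. l1d_norm (\<lambda>t. a n t - c t)) \<longlonglongrightarrow> 0"
  proof (rule tendsto_0_le_inverse_Suc)
    show "0 \<le> l1d_norm (\<lambda>t. a n t - c t)" for n
      by (simp add: l1d_norm_def infsum_nonneg)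
    show "l1d_norm (\<lambda>t. a n t - c t) \<le> 1 / Suc n" for n
      using S(3)[of n] by (simp add: a_def)
  qed
  moreover have "kernel_series K (a n) \<in> B0 K" for n
    unfolding a_def by (rule kernel_series_finite_in_B0[OF S(1,2)])
  ultimately show ?thesis
    by (intro exI[of _ "\<lambda>n. kernel_series K (a n)"]) (simp add: BK_norm_diff[OF a c])
qed

lemma B0_sharp_dense_sequence:
  assumes g: "g \<in> BK_sharp K"
  shows "\<exists>G. (\<forall>n. G n \<in> B0_sharp K) \<and> (\<lambda>n. sup_norm (\<lambda>t. G n t - g t)) \<longlonglongrightarrow> 0"
proof -
  obtain G where G: "\<And>n. G n \<in> B0_sharp K" "\<And>n t. infnorm (G n t - g t) \<le> 1 / Suc n"
    using B0_sharp_approx_sequence[OF BK_sharp_approx[OF g]] by blast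
  have "(\<lambda>n. sup_norm (\<lambda>t. G n t - g t)) \<longlonglongrightarrow> 0"
  proof (rule tendsto_0_le_inverse_Suc)
    show "0 \<le> sup_norm (\<lambda>t. G n t - g t)" for n
      by (intro sup_norm_nonneg bounded_range_infnormI[OF G(2)])
    show "sup_norm (\<lambda>t. G n t - g t) \<le> 1 / Suc n" for n
      by (intro sup_norm_least G(2))
  qed
  with G(1) show ?thesis
    by (intro exI[of _ G] conjI allI)
qed

lemma BK_form_kernel_series:
  assumes c: "c \<in> l1d" and g: "g \<in> BK_sharp K"
  shows "BK_form K (kernel_series K c) g = l1d_pairing c g"
  unfolding BK_form_def
proof (rule the_equality)
  show lim: "\<forall>F G. (\<forall>n. F n \<in> B0 K) \<and> (\<lambda>n. BK_norm K (\<lambda>t. F n t - kernel_series K c t)) \<longlonglongrightarrow> 0 \<and>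
      (\<forall>n. G n \<in> B0_sharp K) \<and> (\<lambda>n. sup_norm (\<lambda>t. G n t - g t)) \<longlonglongrightarrow> 0 \<longrightarrow>
      (\<lambda>n. form0 K (F n) (G n)) \<longlonglongrightarrow> l1d_pairing c g"
  proof (intro allI impI, elim conjE)
    fix F G :: "nat \<Rightarrow> 'x \<Rightarrow> real ^ 'd"
    assume F: "\<forall>n. F n \<in> B0 K" "(\<lambda>n. BK_norm K (\<lambda>t. F n t - kernel_series K c t)) \<longlonglongrightarrow> 0"
      and G: "\<forall>n. G n \<in> B0_sharp K" "(\<lambda>n. sup_norm (\<lambda>t. G n t - g t)) \<longlonglongrightarrow> 0"
    have "\<forall>n. \<exists>a. a \<in> l1d \<and> F n = kernel_series K a"
      using B0_coefficients[OF F(1)[rule_format]] by metis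
    from choice[OF this] obtain a where "\<forall>n. a n \<in> l1d \<and> F n = kernel_series K (a n)"
      by (rule exE)
    then have a: "\<And>n. a n \<in> l1d" "\<And>n. F n = kernel_series K (a n)"
      by auto
    have a_lim: "(\<lambda>n. l1d_norm (\<lambda>t. a n t - c t)) \<longlonglongrightarrow> 0"
      using F(2) by (simp add: a(2) BK_norm_diff[OF a(1) c])
    have "form0 K (F n) (G n) = l1d_pairing (a n) (G n)" for n
      unfolding a(2) using F(1) G(1) by (intro form0_kernel_series a(1)) (simp_all add: a(2)[symmetric])
    moreover have "(\<lambda>n. l1d_pairing (a n) (G n)) \<longlonglongrightarrow> l1d_pairing c g"
    proof (rule Lim_transform_bound[THEN LIM_zero_cancel])
      let ?bound = "\<lambda>n. l1d_norm (\<lambda>t. a n t - c t) * (sup_norm (\<lambda>t. G n t - g t) + sup_norm g) +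
        l1d_norm c * sup_norm (\<lambda>t. G n t - g t)"
      have "?bound \<longlonglongrightarrow> 0 * (0 + sup_norm g) + l1d_norm c * 0"
        by (intro tendsto_intros a_lim G(2))
      then show "?bound \<longlonglongrightarrow> 0"
        by simp
      have "\<bar>l1d_pairing (a n) (G n) - l1d_pairing c g\<bar> \<le> ?bound n" for n
        using G(1) by (intro abs_l1d_pairing_diff_le c a(1) bounded_BK_sharp[OF g] bounded_B0_sharp) simp
      then show "\<forall>\<^sub>F n in sequentially. norm (l1d_pairing (a n) (G n) - l1d_pairing c g) \<le> norm (?bound n)"
        by (intro always_eventually allI) (simp add: order_trans[OF _ abs_ge_self])
    qed
    ultimately show "(\<lambda>n. form0 K (F n) (G n)) \<longlonglongrightarrow> l1d_pairing c g"
      by simp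
  qed
  fix r
  assume r: "\<forall>F G. (\<forall>n. F n \<in> B0 K) \<and> (\<lambda>n. BK_norm K (\<lambda>t. F n t - kernel_series K c t)) \<longlonglongrightarrow> 0 \<and>
      (\<forall>n. G n \<in> B0_sharp K) \<and> (\<lambda>n. sup_norm (\<lambda>t. G n t - g t)) \<longlonglongrightarrow> 0 \<longrightarrow>
      (\<lambda>n. form0 K (F n) (G n)) \<longlonglongrightarrow> r"
  \<comment> \<open>Along concrete approximations of both arguments the same values of
    \<open>form0\<close> tend to \<open>r\<close> and to the pairing.\<close>
  obtain F where F: "\<forall>n. F n \<in> B0 K" "(\<lambda>n. BK_norm K (\<lambda>t. F n t - kernel_series K c t)) \<longlonglongrightarrow> 0"
    using B0_dense_sequence[OF c] by (elim exE conjE)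
  obtain G where G: "\<forall>n. G n \<in> B0_sharp K" "(\<lambda>n. sup_norm (\<lambda>t. G n t - g t)) \<longlonglongrightarrow> 0"
    using B0_sharp_dense_sequence[OF g] by (elim exE conjE)
  show "r = l1d_pairing c g"
    by (rule LIMSEQ_unique[OF r[rule_format, of F G] lim[rule_format, of F G]]) (use F G in simp_all)
qed

section \<open>Bilinearity, joint continuity and the reproducing properties\<close>

lemma bilinear_form_on_BK: "bilinear_form_on (BK K) (BK_sharp K) (BK_form K)"
  unfolding bilinear_form_on_def
proof (intro conjI ballI allI)
  fix f g a
  assume "f \<in> BK K" and g: "g \<in> BK_sharp K"
  from this(1) obtain c where c: "c \<in> l1d" "f = kernel_series K c"
    by (rule BK_E)
  note l1d = normed_fun_spaceD(2,3)[OF normed_fun_space_l1d]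
  note sharp = normed_fun_spaceD(2,3)[OF normed_fun_space_BK_sharp]
  note bounded = bounded_BK_sharp
  show "BK_form K (\<lambda>x. a *\<^sub>R f x) g = a * BK_form K f g"
    using BK_form_kernel_series[OF l1d(2)[OF c(1), of a] g]
    by (simp add: c(2) kernel_series_scaleR BK_form_kernel_series[OF c(1) g] l1d_pairing_scaleR_left)
  show "BK_form K f (\<lambda>x. a *\<^sub>R g x) = a * BK_form K f g"
    by (simp add: c BK_form_kernel_series g sharp(2) l1d_pairing_scaleR_right)
  show "BK_form K (\<lambda>x. f x + f' x) g = BK_form K f g + BK_form K f' g" if "f' \<in> BK K" for f'
  proof -
    from that obtain c' where c': "c' \<in> l1d" "f' = kernel_series K c'"
      by (rule BK_E)
    show ?thesis
      using BK_form_kernel_series[OF l1d(1)[OF c(1) c'(1)] g]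
      by (simp add: c c' kernel_series_add BK_form_kernel_series g l1d_pairing_add_left bounded)
  qed
  show "BK_form K f (\<lambda>x. g x + g' x) = BK_form K f g + BK_form K f g'" if "g' \<in> BK_sharp K" for g'
    by (simp add: c BK_form_kernel_series g that sharp(1) l1d_pairing_add_right bounded)
qed

lemma continuous_map_BK_form:
  "continuous_map (prod_topology (norm_topology (BK K) (BK_norm K)) (norm_topology (BK_sharp K) sup_norm))
    euclidean (\<lambda>(f, g). BK_form K f g)"
proof (rule continuous_map_bilinear_form[OF normed_fun_space_BK normed_fun_space_BK_sharp])
  fix f f' g g'
  assume "f \<in> BK K" "f' \<in> BK K" and g: "g \<in> BK_sharp K" "g' \<in> BK_sharp K"
  then obtain c c' where c: "c \<in> l1d" "f = kernel_series K c" "c' \<in> l1d" "f' = kernel_series K c'"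
    by (elim BK_E)
  show "\<bar>BK_form K f' g' - BK_form K f g\<bar> \<le>
      BK_norm K (\<lambda>x. f' x - f x) * (sup_norm (\<lambda>x. g' x - g x) + sup_norm g) +
      BK_norm K f * sup_norm (\<lambda>x. g' x - g x)"
    using abs_l1d_pairing_diff_le[OF c(1,3) bounded_BK_sharp[OF g(1)] bounded_BK_sharp[OF g(2)]]
    by (simp add: c g BK_form_kernel_series BK_norm_diff BK_norm_kernel_series)
qed

text \<open>The inner product with \<open>v\<close> is bounded and linear, so it commutes with the
  unordered sum of the series; \<open>inner_kernel_commute\<close> then moves each
  \<open>K t x\<close> to the other factor.\<close>

lemma l1d_pairing_kernel:
  assumes "c \<in> l1d"
  shows "l1d_pairing c (\<lambda>t. K t x *v v) = kernel_series K c x \<bullet> v"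
proof -
  have "((\<lambda>t. (K t x *v c t) \<bullet> v) has_sum kernel_series K c x \<bullet> v) UNIV"
    by (rule has_sum_bounded_linear[OF bounded_linear_inner_left has_sum_kernel_series[OF assms]])
  then show ?thesis
    unfolding l1d_pairing_def inner_kernel_commute by (rule infsumI)
qed

lemma reproducing_kernel_BK: "reproducing_kernel K (BK K) (BK_sharp K) (BK_form K)"
  unfolding reproducing_kernel_def
proof (intro allI conjI ballI)
  fix x c
  show sharp: "(\<lambda>t. K t x *v c) \<in> BK_sharp K"
    by (rule B0_sharp_subset_BK_sharp[OF kernel_in_B0_sharp])
  \<comment> \<open>The function \<open>\<lambda>t. K x t *v c\<close> has the point mass at
    \<open>x\<close> as its coefficients, so pairing it with \<open>g\<close> evaluates
    \<open>g\<close> at \<open>x\<close>.\<close>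
  have single: "(\<lambda>t. if t = x then c else 0) \<in> l1d"
    by (rule l1d_finite_support(1)[of "{x}"]) auto
  show "(\<lambda>t. K x t *v c) \<in> BK K"
    using kernel_series_in_BK[OF single] by (simp add: kernel_series_single)
  show "BK_form K f (\<lambda>t. K t x *v c) = f x \<bullet> c" if "f \<in> BK K" for f
  proof -
    from that obtain a where "a \<in> l1d" "f = kernel_series K a"
      by (rule BK_E)
    then show ?thesis
      by (simp add: BK_form_kernel_series sharp l1d_pairing_kernel)
  qed
  show "BK_form K (\<lambda>t. K x t *v c) g = c \<bullet> g x" if "g \<in> BK_sharp K" for g
    using BK_form_kernel_series[OF single that] by (simp add: kernel_series_single l1d_pairing_single)
qed

lemma rkbs_pair_BK: "rkbs_pair K (BK K) (BK_norm K) (BK_sharp K) sup_norm (BK_form K)"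
  unfolding rkbs_pair_def
  by (intro conjI vector_rkbs_BK vector_rkbs_BK_sharp bilinear_form_on_BK continuous_map_BK_form
      reproducing_kernel_BK)

end

theorem theorem2p6:
  fixes K :: "'x \<Rightarrow> 'x \<Rightarrow> real ^ 'd ^ 'd"
  assumes "admissible_kernel K"
  shows "rkbs_pair K (BK K) (BK_norm K) (BK_sharp K) sup_norm (BK_form K) \<and>
    (\<forall>x c. (\<lambda>t. K t x *v c) \<in> BK_sharp K \<and>
           (\<lambda>t. K x t *v c) \<in> BK K \<and>
           (\<forall>f\<in>BK K. BK_form K f (\<lambda>t. K t x *v c) = f x \<bullet> c) \<and>
           (\<forall>g\<in>BK_sharp K. BK_form K (\<lambda>t. K x t *v c) g = c \<bullet> g x))"
proof -
  interpret multitask_kernel K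
    by unfold_locales (rule assms)
  show ?thesis
    using rkbs_pair_BK reproducing_kernel_BK by (simp add: reproducing_kernel_def)
qed

end
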